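(* Let $f$ be a computable observable on $\Omega=\{0,1\}^\infty$ (a computable real-valued function with $\sup_\omega|f(\omega)|<\infty$), and let $T$ be a computable ergodic transformation of $\Omega$ preserving the uniform Bernoulli measure $B_{1/2}$. Then there exists a computable unbounded nondecreasing function $\sigma(n)$ such that for any infinite binary sequence $\omega$, the condition $Km(\omega^n)\ge n-\sigma(n)-O(1)$ (as $n\to\infty$) implies that the limit $\lim_{n\to\infty}\frac{1}{n}\sum_{k=0}^{n-1}f(T^k\omega)$ exists.
   Context: $\Omega$ is the set of infinite binary sequences, $\omega^n=\omega_1\dots\omega_n$ denotes the length-$n$ prefix of $\omega$, and $B_{1/2}$ is the uniform Bernoulli measure, $B_{1/2}(\Gamma_x)=2^{-l(x)}$ for the cylinder $\Gamma_x$ of all infinite extensions of a finite string $x$. $Km(x)$ is the monotonic Kolmogorov complexity of a finite binary string $x$: $Km(x)=\min\{l(p):x\subseteq\psi(p)\}$ for a fixed optimal computable monotonic decoding function $\psi$. $T^0\omega=\omega$, $T^{i+1}\omega=T(T^i\omega)$. A transformation $T$ of $\Omega$ is computable if there is a recursively enumerable set $\hat\psi$ of pairs of strings $(x,y)$ such that: if $(x,y),(x',y')\in\hat\psi$ and $x\subseteq x'$ then $y,y'$ are comparable; if $(x,y)\in\hat\psi$ then $(x,y')\in\hat\psi$ for all prefixes $y'$ of $y$; and $T(\omega)=\sup\{y: x\subseteq\omega,\ (x,y)\in\hat\psi\}$ for all infinite $\omega$. $T$ preserves $B_{1/2}$ if $B_{1/2}(T^{-1}A)=B_{1/2}(A)$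 for all measurable $A$, and is ergodic if every $T$-invariant set has measure $0$ or $1$. The $O(1)$ constant may depend on $\omega$ but not on $n$. *)

theory Defs
  imports "HOL-Probability.Probability" "HOL-Library.Sublist" "HOL-Library.Nat_Bijection"
begin

section \<open>Partial recursive functions\<close>

text \<open>Kleene's schemes, with an evaluation relation on argument lists. Programs carry no arity:
  a program applied to an argument list of unsuitable length simply may have no value.\<close>

datatype recf =
    Zero
  | Succ
  | Proj nat
  | Comp recf "recf list"
  | PrimRec recf recf
  | Mu recf

inductive evaluates :: "recf \<Rightarrow> nat list \<Rightarrow> nat \<Rightarrow> bool" where
  Zero: "evaluates Zero xs 0"
| Succ: "evaluates Succ [x] (Suc x)"
| Proj: "i < length xs \<Longrightarrow> evaluates (Proj i) xs (xs ! i)"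
| Comp: "list_all2 (\<lambda>g y. evaluates g xs y) gs ys \<Longrightarrow> evaluates f ys z
    \<Longrightarrow> evaluates (Comp f gs) xs z"
| PrimRec_0: "evaluates f xs y \<Longrightarrow> evaluates (PrimRec f g) (0 # xs) y"
| PrimRec_Suc: "evaluates (PrimRec f g) (n # xs) y \<Longrightarrow> evaluates g (n # y # xs) z
    \<Longrightarrow> evaluates (PrimRec f g) (Suc n # xs) z"
| Mu: "evaluates f (n # xs) 0 \<Longrightarrow> (\<forall>m<n. \<exists>y. evaluates f (m # xs) (Suc y))
    \<Longrightarrow> evaluates (Mu f) xs n"
monos list_all2_mono

lemma evaluates_deterministic:
  "evaluates p xs y \<Longrightarrow> evaluates p xs z \<Longrightarrow> y = z"
proof (induction arbitrary: z rule: evaluates.induct)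
  case (Zero xs)
  then show ?case by cases auto
next
  case (Succ x)
  then show ?case by cases auto
next
  case (Proj i xs)
  from Proj.prems show ?case by cases auto
next
  case (Comp xs gs ys f z')
  from Comp.prems obtain ys' where ys': "list_all2 (\<lambda>g y. evaluates g xs y) gs ys'"
    and f: "evaluates f ys' z" by cases auto
  have "ys = ys'"
    using Comp.IH(1) ys' by (auto simp: list_all2_conv_all_nth intro!: nth_equalityI)
  with f show ?case using Comp.IH(2) by blast
next
  case (PrimRec_0 f xs y g)
  from PrimRec_0.prems show ?case by cases (use PrimRec_0.IH in auto)
next
  case (PrimRec_Suc f g n xs y z')
  from PrimRec_Suc.prems show ?case
    by cases (use PrimRec_Suc.IH in blast)
next
  case (Mu f n xs)
  from Mu.prems obtain z0: "evaluates f (z # xs) 0"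
    and zl: "\<forall>m<z. \<exists>y. evaluates f (m # xs) (Suc y)" by cases auto
  show ?case
  proof (rule linorder_cases[of n z])
    assume "n < z"
    then obtain y where "evaluates f (n # xs) (Suc y)" using zl by blast
    then show ?thesis using Mu.IH(1) by blast
  next
    assume "z < n"
    then show ?thesis using Mu.IH(2) z0 by blast
  qed
qed

definition total_computable :: "(nat \<Rightarrow> nat) \<Rightarrow> bool" where
  "total_computable h \<longleftrightarrow> (\<exists>p. \<forall>n. evaluates p [n] (h n))"

definition recursively_enumerable :: "nat set \<Rightarrow> bool" where
  "recursively_enumerable A \<longleftrightarrow> (\<exists>p. A = {n. \<exists>y. evaluates p [n] y})"

text \<open>Effective codes of strings and rationals. The encoding provided by class \<open>countable\<close>
  is obtained by a choice operator and must not be used for this purpose.\<close>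

definition string_code :: "bool list \<Rightarrow> nat" where
  "string_code x = list_encode (map of_bool x)"

definition rat_code :: "rat \<Rightarrow> nat" where
  "rat_code q = (case quotient_of q of (a, b) \<Rightarrow> prod_encode (int_encode a, int_encode b))"

lemma inj_string_code: "inj string_code"
proof (rule injI)
  fix x y
  assume "string_code x = string_code y"
  then have "map of_bool x = (map of_bool y :: nat list)"
    by (metis string_code_def list_encode_inverse)
  then show "x = y"
    by (rule map_injective) (simp add: inj_def)
qed

lemma inj_rat_code: "inj rat_code"
  unfolding rat_code_def
  by (rule injI) (auto split: prod.splits dest!: injD[OF inj_int_encode] intro: quotient_of_inject)


section \<open>Finite and infinite binary sequences\<close>

datatype bseq = FinSeq "bool list" | InfSeq "bool stream"

text \<open>The order is the prefix order; \<open>Sup\<close> of a chain is its least upper bound, which is infinite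
  when the chain consists of strings of unbounded length.\<close>

instantiation bseq :: ccpo
begin

fun less_eq_bseq :: "bseq \<Rightarrow> bseq \<Rightarrow> bool" where
  "FinSeq x \<le> FinSeq y \<longleftrightarrow> prefix x y"
| "FinSeq x \<le> InfSeq w \<longleftrightarrow> stake (length x) w = x"
| "InfSeq v \<le> FinSeq y \<longleftrightarrow> False"
| "InfSeq v \<le> InfSeq w \<longleftrightarrow> v = w"

definition less_bseq :: "bseq \<Rightarrow> bseq \<Rightarrow> bool" where
  "less_bseq s t \<longleftrightarrow> s \<le> t \<and> \<not> t \<le> s"

definition Sup_bseq :: "bseq set \<Rightarrow> bseq" where
  "Sup_bseq A = (THE s. (\<forall>a\<in>A. a \<le> s) \<and> (\<forall>t. (\<forall>a\<in>A. a \<le> t) \<longrightarrow> s \<le> t))"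

instance
proof -
  have refl: "s \<le> s" for s :: bseq
    by (cases s) auto
  have antisym: "s = t" if "s \<le> t" "t \<le> s" for s t :: bseq
    using that by (cases s; cases t) auto
  have stake_prefix: "stake (length x) w = x" if "prefix x y" "stake (length y) w = y"
    for x y :: "bool list" and w
  proof -
    have "x = take (length x) (stake (length y) w)"
      using that by (auto simp: prefix_def)
    also have "\<dots> = stake (length x) w"
      using prefix_length_le[OF that(1)] by (simp add: take_stake min_def)
    finally show ?thesis by simp
  qed
  have trans: "s \<le> u" if "s \<le> t" "t \<le> u" for s t u :: bseq
    using that by (cases s; cases t; cases u) (auto intro: stake_prefix)
  have max: "\<exists>s. (\<forall>a\<in>A. a \<le> s) \<and> (\<forall>t. (\<forall>a\<in>A. a \<le> t) \<longrightarrow> s \<le> t)"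
    if "m \<in> A" "\<forall>a\<in>A. a \<le> m" for A :: "bseq set" and m
    using that by blast
  have ex: "\<exists>s. (\<forall>a\<in>A. a \<le> s) \<and> (\<forall>t. (\<forall>a\<in>A. a \<le> t) \<longrightarrow> s \<le> t)"
    if ch: "Complete_Partial_Order.chain (\<le>) A" for A :: "bseq set"
  proof (cases "\<exists>w. InfSeq w \<in> A")
    case True
    then obtain w where w: "InfSeq w \<in> A" by blast
    have "a \<le> InfSeq w" if "a \<in> A" for a
      using chainD[OF ch that w] by (cases a) auto
    then show ?thesis using max[OF w] by blast
  next
    case False
    define L where "L = {x. FinSeq x \<in> A}"
    have A: "A = FinSeq ` L"
      using False by (auto simp: L_def image_iff) (metis bseq.exhaust)
    have cmp: "prefix x y \<or> prefix y x" if "x \<in> L" "y \<in> L" for x y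
      using chainD[OF ch, of "FinSeq x" "FinSeq y"] that by (auto simp: L_def)
    have le: "prefix x y" if "x \<in> L" "y \<in> L" "length x \<le> length y" for x y
      using cmp[OF that(1,2)] that(3)
      by (metis prefix_length_le prefix_order.eq_iff prefix_length_prefix)
    show ?thesis
    proof (cases "\<exists>N. \<forall>x\<in>L. length x \<le> N")
      case bd: True
      show ?thesis
      proof (cases "L = {}")
        case True
        have "FinSeq [] \<le> t" for t by (cases t) auto
        then show ?thesis using True A by blast
      next
        case False
        obtain N where N: "\<forall>x\<in>L. length x < N" using bd by (metis le_imp_less_Suc)
        obtain x0 where "x0 \<in> L" using False by blast
        then obtain m where m: "m \<in> L" "\<forall>y. y \<in> L \<longrightarrow> length y \<le> length m"
          using ex_has_greatest_nat[of "\<lambda>x. x \<in> L" x0 length N] N less_imp_le by blast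
        have "\<forall>a\<in>A. a \<le> FinSeq m" using m le by (auto simp: A)
        then show ?thesis using max[of "FinSeq m" A] m A by blast
      qed
    next
      case unb: False
      then have ex_long: "\<exists>y\<in>L. n < length y" for n by (meson not_le)
      then obtain Y where Y: "\<And>n. Y n \<in> L" "\<And>n. n < length (Y n)" by metis
      define w where "w = to_stream (\<lambda>n. Y n ! n)"
      have nth: "w !! n = Y n ! n" for n
        by (simp add: w_def to_stream_def snth_smap)
      have agree: "x ! n = Y n ! n" if "x \<in> L" "n < length x" for x n
        using cmp[OF that(1) Y(1)[of n]] that(2) Y(2)[of n] by (auto simp: prefix_def nth_append)
      have ub: "stake (length x) w = x" if "x \<in> L" for x
        by (rule nth_equalityI) (use that in \<open>auto simp: nth agree stake_nth\<close>)
      have lub: "InfSeq w \<le> t" if t: "\<forall>a\<in>A. a \<le> t" for t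
      proof (cases t)
        case (FinSeq z)
        obtain y where "y \<in> L" "length z < length y" using ex_long by blast
        then show ?thesis using t FinSeq prefix_length_le[of y z] by (auto simp: A)
      next
        case (InfSeq v)
        have "w !! n = v !! n" for n
        proof -
          have s: "stake (length (Y n)) v = Y n" using t Y(1)[of n] InfSeq by (auto simp: A)
          have "v !! n = stake (length (Y n)) v ! n" using Y(2)[of n] by (simp add: stake_nth)
          then show ?thesis using s nth by simp
        qed
        then have "w = v" by (subst (1 2) stream_smap_nats) (simp cong: stream.map_cong0)
        then show ?thesis using InfSeq by simp
      qed
      have "\<forall>a\<in>A. a \<le> InfSeq w" using ub by (auto simp: A)
      then show ?thesis using lub by blast
    qed
  qed
  have Sup: "(\<forall>a\<in>A. a \<le> Sup A) \<and> (\<forall>t. (\<forall>a\<in>A. a \<le> t) \<longrightarrow> Sup A \<le> t)"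
    if "Complete_Partial_Order.chain (\<le>) A" for A :: "bseq set"
    unfolding Sup_bseq_def
    by (rule theI') (use ex[OF that] antisym in blast)
  show "OFCLASS(bseq, ccpo_class)"
    by intro_classes (use refl antisym trans Sup in \<open>auto simp: less_bseq_def\<close>)
qed

end


section \<open>Computable monotonic mappings and monotonic complexity\<close>

definition monotone_graph :: "(bool list \<times> bool list) set \<Rightarrow> bool" where
  "monotone_graph G \<longleftrightarrow>
     (\<forall>x y x' y'. (x, y) \<in> G \<longrightarrow> (x', y') \<in> G \<longrightarrow> prefix x x' \<longrightarrow> prefix y y' \<or> prefix y' y) \<and>
     (\<forall>x y y'. (x, y) \<in> G \<longrightarrow> prefix y' y \<longrightarrow> (x, y') \<in> G)"

definition graph_map :: "(bool list \<times> bool list) set \<Rightarrow> bseq \<Rightarrow> bseq" where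
  "graph_map G s = Sup {FinSeq y | y. \<exists>x. FinSeq x \<le> s \<and> (x, y) \<in> G}"

lemma chain_graph_map:
  assumes "monotone_graph G"
  shows "Complete_Partial_Order.chain (\<le>) {FinSeq y | y. \<exists>x. FinSeq x \<le> s \<and> (x, y) \<in> G}"
proof (rule chainI)
  fix a b
  assume "a \<in> {FinSeq y | y. \<exists>x. FinSeq x \<le> s \<and> (x, y) \<in> G}"
    and "b \<in> {FinSeq y | y. \<exists>x. FinSeq x \<le> s \<and> (x, y) \<in> G}"
  then obtain x y x' y' where *: "a = FinSeq y" "FinSeq x \<le> s" "(x, y) \<in> G"
    "b = FinSeq y'" "FinSeq x' \<le> s" "(x', y') \<in> G" by blast
  have "prefix x x' \<or> prefix x' x"
  proof (cases s)
    case (FinSeq z)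
    then show ?thesis using * prefix_same_cases by fastforce
  next
    case (InfSeq w)
    then have "x = stake (length x) w" "x' = stake (length x') w" using * by auto
    then show ?thesis
      by (metis le_cases min.absorb1 take_is_prefix take_stake)
  qed
  then show "a \<le> b \<or> b \<le> a"
    using assms * unfolding monotone_graph_def by (metis less_eq_bseq.simps(1))
qed

definition computable_monotonic :: "(bseq \<Rightarrow> bseq) \<Rightarrow> bool" where
  "computable_monotonic \<psi> \<longleftrightarrow>
     (\<exists>G. monotone_graph G \<and>
          recursively_enumerable ((\<lambda>(x, y). prod_encode (string_code x, string_code y)) ` G) \<and>
          \<psi> = graph_map G)"

text \<open>The infimum is a minimum in \<open>enat\<close>, being \<open>\<infinity>\<close> when no program describes \<open>x\<close>; this
  happens for no string when \<open>\<psi>\<close> is optimal.\<close>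

definition Km :: "(bseq \<Rightarrow> bseq) \<Rightarrow> bool list \<Rightarrow> enat" where
  "Km \<psi> x = (INF p \<in> {p. FinSeq x \<le> \<psi> (FinSeq p)}. enat (length p))"

definition optimal_decoder :: "(bseq \<Rightarrow> bseq) \<Rightarrow> bool" where
  "optimal_decoder \<psi> \<longleftrightarrow> computable_monotonic \<psi> \<and>
     (\<forall>\<phi>. computable_monotonic \<phi> \<longrightarrow> (\<exists>c::nat. \<forall>x. Km \<psi> x \<le> Km \<phi> x + enat c))"

definition computable_transformation :: "(bool stream \<Rightarrow> bool stream) \<Rightarrow> bool" where
  "computable_transformation T \<longleftrightarrow>
     (\<exists>\<psi>. computable_monotonic \<psi> \<and> (\<forall>w. \<psi> (InfSeq w) = InfSeq (T w)))"

text \<open>A real function on infinite sequences is computable when, from a precision \<open>k\<close> and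
  sufficiently long prefixes of the argument, one can enumerate rational approximations of its
  value with error below \<open>2 ^ -k\<close>, at least one of them for every argument and every \<open>k\<close>.\<close>

definition computable_real_function :: "(bool stream \<Rightarrow> real) \<Rightarrow> bool" where
  "computable_real_function f \<longleftrightarrow>
     (\<exists>W :: (bool list \<times> nat \<times> rat) set.
        recursively_enumerable
          ((\<lambda>(x, k, q). prod_encode (string_code x, prod_encode (k, rat_code q))) ` W) \<and>
        (\<forall>x k q w. (x, k, q) \<in> W \<longrightarrow> FinSeq x \<le> InfSeq w \<longrightarrow> \<bar>f w - of_rat q\<bar> < 1 / 2 ^ k) \<and>
        (\<forall>w k. \<exists>x q. FinSeq x \<le> InfSeq w \<and> (x, k, q) \<in> W))"

definition computable_observable :: "(bool stream \<Rightarrow> real) \<Rightarrow> bool" where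
  "computable_observable f \<longleftrightarrow> computable_real_function f \<and> bounded (range f)"


section \<open>The uniform Bernoulli measure and ergodicity\<close>

definition B_half :: "bool stream measure" where
  "B_half = stream_space (measure_pmf (bernoulli_pmf (1 / 2)))"

lemma space_B_half [simp]: "space B_half = UNIV"
  by (simp add: B_half_def space_stream_space)

lemma prob_space_B_half: "prob_space B_half"
  unfolding B_half_def by (rule prob_space.prob_space_stream_space[OF prob_space_measure_pmf])

lemma sets_cylinder: "{w. stake (length x) w = x} \<in> sets B_half"
proof -
  have "{w \<in> space (stream_space (count_space UNIV)). stake (length x) w = x}
      \<in> sets (stream_space (count_space (UNIV :: bool set)))"
    by measurable
  also have "sets (stream_space (count_space (UNIV :: bool set))) = sets B_half"
    unfolding B_half_def by (rule sets_stream_space_cong) simp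
  finally show ?thesis by (simp add: space_stream_space)
qed

lemma emeasure_cylinder:
  "emeasure B_half {w. stake (length x) w = x} = ennreal ((1 / 2) ^ length x)"
proof (induction x)
  case Nil
  then show ?case using prob_space.emeasure_space_1[OF prob_space_B_half] by simp
next
  case (Cons b x)
  let ?C = "{w. stake (length (b # x)) w = b # x}"
  have "emeasure B_half ?C =
      (\<integral>\<^sup>+t. emeasure B_half {w. t ## w \<in> ?C} \<partial>measure_pmf (bernoulli_pmf (1 / 2)))"
    using prob_space.emeasure_stream_space[OF prob_space_measure_pmf, of ?C]
      sets_cylinder[of "b # x"]
    by (simp add: B_half_def space_stream_space)
  also have "\<dots> = (\<integral>\<^sup>+t. ennreal ((1 / 2) ^ length x) * indicator {b} t
      \<partial>measure_pmf (bernoulli_pmf (1 / 2)))"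
    by (rule nn_integral_cong) (auto simp: Cons split: split_indicator)
  also have "\<dots> = ennreal ((1 / 2) ^ length x) * ennreal (1 / 2)"
    by (cases b) (simp_all add: nn_integral_cmult_indicator emeasure_pmf_single)
  also have "\<dots> = ennreal ((1 / 2) ^ length (b # x))"
    by (subst ennreal_mult[symmetric]) (simp_all add: mult.commute)
  finally show ?case .
qed

definition preserves_measure :: "'a measure \<Rightarrow> ('a \<Rightarrow> 'a) \<Rightarrow> bool" where
  "preserves_measure M T \<longleftrightarrow> T \<in> measurable M M \<and>
     (\<forall>A\<in>sets M. emeasure M (T -` A \<inter> space M) = emeasure M A)"

definition ergodic :: "'a measure \<Rightarrow> ('a \<Rightarrow> 'a) \<Rightarrow> bool" where
  "ergodic M T \<longleftrightarrow>
     (\<forall>A\<in>sets M. T -` A \<inter> space M = A \<longrightarrow> emeasure M A = 0 \<or> emeasure M A = 1)"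

end

theory Submission
  imports Defs
begin

text \<open>
  For an ergodic \<open>T\<close> the rate of convergence of the Birkhoff averages \<open>A n f\<close> is computable. Some
  \<open>A M f\<close> is close in mean to a rational number \<open>q\<close>, and this can be verified on finitely many
  prefixes, so that a search finds such \<open>M\<close> and \<open>q\<close> for every precision. By the maximal ergodic
  inequality, applied to \<open>A M f - q\<close>, the average \<open>A n f\<close> then stays close to \<open>q\<close> for all
  \<open>n \<ge> N\<close>, outside a set of small measure, where \<open>N\<close> is computed from \<open>M\<close>.

  In stage \<open>i\<close> the averages are within about \<open>2 ^ -i\<close> of \<open>q\<close> for all \<open>n\<close> from \<open>N i\<close> up to
  \<open>N (i + 1)\<close>, except on a union of at most \<open>2 ^ (L i - 3 * i)\<close> cylinders of some computable length
  \<open>L i\<close>. An element of the exceptional set has therefore \<open>Km (\<omega>^(L i)) \<le> L i - 2 * i + O(1)\<close>,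
  where \<open>i\<close> extra bits identify the stage. If \<open>\<sigma> (L i) \<le> i\<close>, the hypothesis excludes this for
  almost all \<open>i\<close>, so the averages converge. Hence \<open>\<sigma>\<close> is the generalised inverse of \<open>L\<close>.
\<close>

section \<open>Total computable functions of natural numbers\<close>

text \<open>Birkhoff's theorem alone gives no computable rate of convergence. What provides one is
  that the maximal inequality bounds the averages of \<open>A M f - q\<close> whatever the last
  index is, so \<open>N i\<close> can be fixed before \<open>L i\<close> is searched for. Limiting
  stage \<open>i\<close> to finitely many \<open>n\<close> makes its exceptional set a union of
  cylinders of one length, which finite lists can certify. Comparison of computable reals is
  undecidable, so every condition is phrased with natural numbers and existential witnesses.

  The constants arise as follows. The maximal inequality at threshold \<open>2 ^ -i\<close> costs a
  factor \<open>2 ^ i\<close>, so a mean error below \<open>2 ^ -(4 * i)\<close> yields exceptional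
  measure below \<open>2 ^ -(3 * i)\<close>. Of the exponent \<open>3 * i\<close>, one
  \<open>i\<close> pays for the stage number, one for \<open>\<sigma> (L i)\<close>, and the last
  one outgrows every additive constant. This is why \<open>\<sigma>\<close> can be chosen
  independently of the sequence and of its constant.\<close>

definition computes1 :: "recf \<Rightarrow> (nat \<Rightarrow> nat) \<Rightarrow> bool" where
  "computes1 p F \<longleftrightarrow> (\<forall>x. evaluates p [x] (F x))"

definition computes2 :: "recf \<Rightarrow> (nat \<Rightarrow> nat \<Rightarrow> nat) \<Rightarrow> bool" where
  "computes2 p F \<longleftrightarrow> (\<forall>x y. evaluates p [x, y] (F x y))"

lemma evaluates_Comp1:
  "evaluates g xs a \<Longrightarrow> evaluates f [a] z \<Longrightarrow> evaluates (Comp f [g]) xs z"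
  by (rule evaluates.Comp[of _ _ "[a]"]) auto

lemma evaluates_Comp2:
  "evaluates g xs a \<Longrightarrow> evaluates h xs b \<Longrightarrow> evaluates f [a, b] z
    \<Longrightarrow> evaluates (Comp f [g, h]) xs z"
  by (rule evaluates.Comp[of _ _ "[a, b]"]) auto

lemma evaluates_Proj:
  "evaluates (Proj 0) (x # xs) x"
  "evaluates (Proj 1) (x # y # xs) y"
  "evaluates (Proj 2) (x # y # z # xs) z"
  using evaluates.Proj[of 0 "x # xs"] evaluates.Proj[of 1 "x # y # xs"]
    evaluates.Proj[of 2 "x # y # z # xs"] by auto

lemma evaluates_PrimRec:
  assumes "evaluates f xs (r 0)"
    and "\<And>m. m < n \<Longrightarrow> evaluates g (m # r m # xs) (r (Suc m))"
  shows "evaluates (PrimRec f g) (n # xs) (r n)"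
  using assms(2)
proof (induction n)
  case 0
  then show ?case using evaluates.PrimRec_0 assms(1) by blast
next
  case (Suc n)
  then show ?case by (meson evaluates.PrimRec_Suc less_Suc_eq)
qed

lemma evaluates_Mu_Least:
  assumes "\<And>n. evaluates f (n # xs) (h n)" and "\<exists>n. h n = 0"
  shows "evaluates (Mu f) xs (LEAST n. h n = 0)"
proof (rule evaluates.Mu)
  have "h (LEAST n. h n = 0) = 0" using assms(2) by (rule LeastI_ex)
  then show "evaluates f ((LEAST n. h n = 0) # xs) 0" by (metis assms(1))
  show "\<forall>m<(LEAST n. h n = 0). \<exists>y. evaluates f (m # xs) (Suc y)"
    using not_less_Least assms(1) by (metis not0_implies_Suc)
qed

lemma computes1_const: "\<exists>p. computes1 p (\<lambda>_. c)"
proof (induction c)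
  case 0
  then show ?case using evaluates.Zero unfolding computes1_def by blast
next
  case (Suc c)
  then obtain p where "computes1 p (\<lambda>_. c)" by blast
  then have "computes1 (Comp Succ [p]) (\<lambda>_. Suc c)"
    unfolding computes1_def using evaluates_Comp1 evaluates.Succ by blast
  then show ?case by blast
qed

lemma computes2_add: "\<exists>p. computes2 p (+)"
proof -
  have "computes2 (PrimRec (Proj 0) (Comp Succ [Proj 1])) (+)"
    unfolding computes2_def
  proof (intro allI)
    fix x y
    show "evaluates (PrimRec (Proj 0) (Comp Succ [Proj 1])) [x, y] (x + y)"
      by (rule evaluates_PrimRec[where r = "\<lambda>n. n + y"])
        (auto intro!: evaluates_Comp1 evaluates_Proj[simplified] evaluates.Succ)
  qed
  then show ?thesis by blast
qed

lemma computes1_pred: "\<exists>p. computes1 p (\<lambda>n. n - 1)"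
proof -
  have "computes1 (PrimRec Zero (Proj 0)) (\<lambda>n. n - 1)"
    unfolding computes1_def
    by (intro allI evaluates_PrimRec) (auto intro: evaluates.Zero evaluates_Proj)
  then show ?thesis by blast
qed

text \<open>The arguments are swapped because primitive recursion runs over the first one, which
  counts the applications of the predecessor.\<close>

lemma computes2_diff: "\<exists>p. computes2 p (\<lambda>x y. y - x)"
proof -
  obtain q where q: "computes1 q (\<lambda>n. n - 1)" using computes1_pred by blast
  have "computes2 (PrimRec (Proj 0) (Comp q [Proj 1])) (\<lambda>x y. y - x)"
    unfolding computes2_def
  proof (intro allI)
    fix x y
    show "evaluates (PrimRec (Proj 0) (Comp q [Proj 1])) [x, y] (y - x)"
    proof (rule evaluates_PrimRec[where r = "\<lambda>n. y - n"])
      fix m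
      have "evaluates q [y - m] (y - m - 1)" using q unfolding computes1_def by blast
      then show "evaluates (Comp q [Proj 1]) [m, y - m, y] (y - Suc m)"
        by (auto intro!: evaluates_Comp1 evaluates_Proj[simplified])
    qed (auto intro: evaluates_Proj)
  qed
  then show ?thesis by blast
qed

lemma computes1_triangle: "\<exists>p. computes1 p triangle"
proof -
  obtain q where q: "computes2 q (+)" using computes2_add by blast
  have "computes1 (PrimRec Zero (Comp Succ [Comp q [Proj 0, Proj 1]])) triangle"
    unfolding computes1_def
  proof (intro allI evaluates_PrimRec)
    fix m
    have "evaluates q [m, triangle m] (m + triangle m)" using q by (simp add: computes2_def)
    then show "evaluates (Comp Succ [Comp q [Proj 0, Proj 1]]) [m, triangle m] (triangle (Suc m))"
      using evaluates.Succ[of "m + triangle m"]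
      by (auto intro!: evaluates_Comp1 evaluates_Comp2 evaluates_Proj[simplified] simp: add.commute)
  qed (auto intro: evaluates.Zero)
  then show ?thesis by blast
qed

lemma computes2_prod_encode: "\<exists>p. computes2 p (\<lambda>x y. prod_encode (x, y))"
proof -
  obtain q t where q: "computes2 q (+)" and t: "computes1 t triangle"
    using computes2_add computes1_triangle by blast
  have "computes2 (Comp q [Comp t [Comp q [Proj 0, Proj 1]], Proj 0]) (\<lambda>x y. prod_encode (x, y))"
    unfolding computes2_def
  proof (intro allI)
    fix x y
    have "evaluates q [x, y] (x + y)" "evaluates t [x + y] (triangle (x + y))"
      "evaluates q [triangle (x + y), x] (triangle (x + y) + x)"
      using q t by (auto simp: computes2_def computes1_def)
    then show "evaluates (Comp q [Comp t [Comp q [Proj 0, Proj 1]], Proj 0]) [x, y] (prod_encode (x, y))"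
      by (auto simp: prod_encode_def intro!: evaluates_Comp1 evaluates_Comp2 evaluates_Proj[simplified])
  qed
  then show ?thesis by blast
qed

text \<open>The diagonal containing \<open>z\<close> is found by unbounded search.\<close>

lemma prod_decode_triangle:
  fixes z :: nat
  defines "w \<equiv> LEAST w. Suc z - triangle (Suc w) = 0"
  shows "prod_decode z = (z - triangle w, w - (z - triangle w))"
proof -
  obtain a b where ab: "z = prod_encode (a, b)" by (metis prod_decode_inverse surj_pair)
  have mono: "triangle m \<le> triangle n" if "m \<le> n" for m n
    using that by (induction rule: dec_induct) auto
  have "w = a + b"
    unfolding w_def
  proof (rule Least_equality)
    show "Suc z - triangle (Suc (a + b)) = 0" using ab by (simp add: prod_encode_def)
  next
    fix v
    assume "Suc z - triangle (Suc v) = 0"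
    then have "z < triangle (Suc v)" by simp
    moreover have "triangle (a + b) \<le> z" using ab by (simp add: prod_encode_def)
    ultimately show "a + b \<le> v" using mono[of "Suc v" "a + b"] by (meson leD le_trans not_less_eq_eq)
  qed
  moreover have "prod_decode z = (a, b)" "z = triangle (a + b) + a"
    using ab by (simp, simp add: prod_encode_def)
  ultimately show ?thesis by simp
qed

lemma computes1_prod_decode:
  "\<exists>p. computes1 p (\<lambda>z. fst (prod_decode z))" "\<exists>p. computes1 p (\<lambda>z. snd (prod_decode z))"
proof -
  obtain d t where d: "computes2 d (\<lambda>x y. y - x)" and t: "computes1 t triangle"
    using computes2_diff computes1_triangle by blast
  define w where "w z = (LEAST w. Suc z - triangle (Suc w) = 0)" for z
  \<comment> \<open>The truncated difference vanishes exactly if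
    \<open>z < triangle (Suc v)\<close>, so its least zero is the index of the diagonal through
    \<open>z\<close>.\<close>
  let ?s = "Comp d [Comp t [Comp Succ [Proj 0]], Comp Succ [Proj 1]]"
  have ex: "\<exists>v. Suc z - triangle (Suc v) = 0" for z
    by (rule exI[of _ z]) (induction z, auto)
  have W: "evaluates (Mu ?s) [z] (w z)" for z
    unfolding w_def
  proof (rule evaluates_Mu_Least[OF _ ex])
    fix v
    have "evaluates d [triangle (Suc v), Suc z] (Suc z - triangle (Suc v))"
      "evaluates t [Suc v] (triangle (Suc v))"
      using d t unfolding computes2_def computes1_def by blast+
    then show "evaluates ?s [v, z] (Suc z - triangle (Suc v))"
      by (auto intro!: evaluates_Comp1 evaluates_Comp2 evaluates_Proj[simplified] evaluates.Succ
          simp del: triangle_Suc)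
  qed
  let ?a = "Comp d [Comp t [Mu ?s], Proj 0]"
  have A: "evaluates ?a [z] (z - triangle (w z))" for z
  proof -
    have "evaluates d [triangle (w z), z] (z - triangle (w z))" "evaluates t [w z] (triangle (w z))"
      using d t unfolding computes2_def computes1_def by blast+
    then show ?thesis using W evaluates_Comp1 evaluates_Comp2 evaluates_Proj by blast
  qed
  have B: "evaluates (Comp d [?a, Mu ?s]) [z] (w z - (z - triangle (w z)))" for z
  proof -
    have "evaluates d [z - triangle (w z), w z] (w z - (z - triangle (w z)))"
      using d unfolding computes2_def by blast
    then show ?thesis using A W evaluates_Comp2 by blast
  qed
  show "\<exists>p. computes1 p (\<lambda>z. fst (prod_decode z))"
    using A unfolding computes1_def w_def prod_decode_triangle fst_conv by blast
  show "\<exists>p. computes1 p (\<lambda>z. snd (prod_decode z))"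
    using B unfolding computes1_def w_def prod_decode_triangle snd_conv by blast
qed


section \<open>Effectively encoded types\<close>

text \<open>Codes are bijective so that every number decodes to a value and searches need no test
  for validity. Finite types are thereby excluded: predicates pass through \<open>of_bool\<close>
  into \<open>nat\<close>, and bits are natural numbers.\<close>

class encodable =
  fixes encode :: "'a \<Rightarrow> nat"
  assumes bij_encode: "bij encode"
begin

definition decode :: "nat \<Rightarrow> 'a" where
  "decode = inv encode"

lemma decode_encode [simp]: "decode (encode a) = a"
  using bij_encode by (simp add: decode_def bij_is_inj)

lemma encode_decode [simp]: "encode (decode n) = n"
  using bij_encode by (simp add: decode_def bij_is_surj surj_f_inv_f)

lemma encode_eq_iff [simp]: "encode a = encode b \<longleftrightarrow> a = b"
  by (metis decode_encode)

end

instantiation nat :: encodable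
begin
definition encode_nat :: "nat \<Rightarrow> nat" where [simp]: "encode_nat n = n"
instance by standard (simp add: encode_nat_def[abs_def] bij_id[unfolded id_def])
end

instantiation prod :: (encodable, encodable) encodable
begin
definition encode_prod :: "'a \<times> 'b \<Rightarrow> nat" where
  [simp]: "encode_prod p = prod_encode (encode (fst p), encode (snd p))"
instance
proof
  show "bij (encode :: 'a \<times> 'b \<Rightarrow> nat)"
  proof (rule o_bij[where g = "\<lambda>n. map_prod decode decode (prod_decode n)"])
  qed (auto simp: fun_eq_iff map_prod_def split: prod.splits, metis prod_decode_inverse)
qed
end

lemma decode_prod: "decode n = (decode (fst (prod_decode n)), decode (snd (prod_decode n)))"
proof -
  have "encode (decode (fst (prod_decode n)) :: 'a, decode (snd (prod_decode n)) :: 'b) = n"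
    by simp
  then show ?thesis by (metis decode_encode)
qed

instantiation list :: (encodable) encodable
begin
definition encode_list :: "'a list \<Rightarrow> nat" where
  "encode_list xs = list_encode (map encode xs)"
instance
proof
  show "bij (encode :: 'a list \<Rightarrow> nat)"
  proof (rule o_bij[where g = "\<lambda>n. map decode (list_decode n)"])
    show "(\<lambda>n. map decode (list_decode n)) \<circ> encode = (id :: 'a list \<Rightarrow> _)"
      by (simp add: fun_eq_iff encode_list_def comp_def)
    show "(encode :: 'a list \<Rightarrow> nat) \<circ> (\<lambda>n. map decode (list_decode n)) = id"
      by (simp add: fun_eq_iff encode_list_def comp_def)
  qed
qed
end

lemma encode_Nil [simp]: "encode [] = 0"
  by (simp add: encode_list_def)

lemma encode_Cons [simp]: "encode (x # xs) = Suc (prod_encode (encode x, encode xs))"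
  by (simp add: encode_list_def)


section \<open>Computable functions on encoded types\<close>

definition computable :: "('a::encodable \<Rightarrow> 'b::encodable) \<Rightarrow> bool" where
  "computable f \<longleftrightarrow> (\<exists>p. \<forall>a. evaluates p [encode a] (encode (f a)))"

text \<open>Each rule combines computable functions of one common variable, so that resolution
  follows the structure of a term. Where a bound variable is added, it is packed with the old one
  into a pair.\<close>

named_theorems computable_intros

lemma computable_computes1: "computable f \<longleftrightarrow> (\<exists>p. computes1 p (\<lambda>n. encode (f (decode n))))"
  unfolding computable_def computes1_def by (metis decode_encode encode_decode)

lemma computable_nat_iff: "computable (h :: nat \<Rightarrow> nat) \<longleftrightarrow> total_computable h"
  by (simp add: computable_def total_computable_def)

lemma computable_ident [computable_intros]: "computable (\<lambda>x. x)"
  unfolding computable_def using evaluates_Proj(1) by blast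

lemma computable_const [computable_intros]: "computable (\<lambda>_. c)"
  using computes1_const unfolding computable_computes1 by blast

lemma computable_comp:
  assumes "computable f" "computable g"
  shows "computable (\<lambda>x. f (g x))"
  using assms evaluates_Comp1 unfolding computable_def by metis

lemma computable_Pair [computable_intros]:
  assumes "computable f" "computable g"
  shows "computable (\<lambda>x. (f x, g x))"
proof -
  obtain p q r where "computes2 r (\<lambda>x y. prod_encode (x, y))"
    and "\<forall>a. evaluates p [encode a] (encode (f a))" "\<forall>a. evaluates q [encode a] (encode (g a))"
    using assms computes2_prod_encode unfolding computable_def by blast
  then have "evaluates (Comp r [p, q]) [encode a] (encode (f a, g a))" for a
    by (auto intro!: evaluates_Comp2 simp: computes2_def)
  then show ?thesis unfolding computable_def by blast
qed

lemma computable_fst [computable_intros]: "computable f \<Longrightarrow> computable (\<lambda>x. fst (f x))"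
  by (rule computable_comp[of fst])
    (use computes1_prod_decode(1) in \<open>simp_all add: computable_computes1 decode_prod\<close>)

lemma computable_snd [computable_intros]: "computable f \<Longrightarrow> computable (\<lambda>x. snd (f x))"
  by (rule computable_comp[of snd])
    (use computes1_prod_decode(2) in \<open>simp_all add: computable_computes1 decode_prod\<close>)

lemma computable_Suc [computable_intros]: "computable f \<Longrightarrow> computable (\<lambda>x. Suc (f x))"
  by (rule computable_comp[of Suc]) (auto simp: computable_def intro: evaluates.Succ)

text \<open>A program for the step receives a single code, so index, previous value and parameter
  are repacked into a triple each time. Case distinction, arithmetic and \<open>drop\<close> are
  derived from this scheme.\<close>

lemma computable_rec_nat [computable_intros]:
  fixes r :: "'a::encodable \<Rightarrow> 'b::encodable"
  assumes n: "computable n" and g: "computable g"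
    and h: "computable (\<lambda>p. h (fst p) (fst (snd p)) (snd (snd p)))"
  shows "computable (\<lambda>x. rec_nat (g x) (\<lambda>m r. h m r x) (n x))"
proof -
  obtain pg ph pp where pg: "\<And>a. evaluates pg [encode a] (encode (g a))"
    and ph: "\<And>m r x. evaluates ph [encode (m, r, x)] (encode (h m r x))"
    and pp: "\<And>x y. evaluates pp [x, y] (prod_encode (x, y))"
    using g h computes2_prod_encode unfolding computable_def computes2_def
    by (metis fst_conv snd_conv)
  let ?p = "PrimRec pg (Comp ph [Comp pp [Proj 0, Comp pp [Proj 1, Proj 2]]])"
  have "evaluates ?p [k, encode x] (encode (rec_nat (g x) (\<lambda>m r. h m r x) k))" for k x
  proof (rule evaluates_PrimRec[where r = "\<lambda>k. encode (rec_nat (g x) (\<lambda>m r. h m r x) k)"])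
    show "evaluates pg [encode x] (encode (rec_nat (g x) (\<lambda>m r. h m r x) 0))" using pg by simp
  next
    fix m
    let ?r = "rec_nat (g x) (\<lambda>m r. h m r x) m"
    have "evaluates ph [prod_encode (m, prod_encode (encode ?r, encode x))] (encode (h m ?r x))"
      using ph[of m ?r x] by simp
    then show "evaluates (Comp ph [Comp pp [Proj 0, Comp pp [Proj 1, Proj 2]]])
        [m, encode ?r, encode x] (encode (rec_nat (g x) (\<lambda>m r. h m r x) (Suc m)))"
      by (auto intro!: evaluates_Comp1 evaluates_Comp2[OF _ _ pp]
          intro: evaluates_Proj evaluates_Proj[simplified])
  qed
  moreover obtain pn where "\<And>a. evaluates pn [encode a] (n a)"
    using n unfolding computable_def by auto
  ultimately have "evaluates (Comp ?p [pn, Proj 0]) [encode x]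
      (encode (rec_nat (g x) (\<lambda>m r. h m r x) (n x)))" for x
    by (auto intro!: evaluates_Comp2 evaluates_Proj)
  then show ?thesis unfolding computable_def by blast
qed

lemma computable_Least [computable_intros]:
  fixes d :: "'a::encodable \<Rightarrow> nat \<Rightarrow> nat"
  assumes d: "computable (\<lambda>p. d (fst p) (snd p))" and ex: "\<And>x. \<exists>n. d x n = 0"
  shows "computable (\<lambda>x. LEAST n. d x n = 0)"
proof -
  obtain pd pp where pd: "\<And>x n. evaluates pd [encode (x, n)] (d x n)"
    and pp: "\<And>x y. evaluates pp [x, y] (prod_encode (x, y))"
    using d computes2_prod_encode unfolding computable_def computes2_def
    by (metis encode_nat_def fst_conv snd_conv)
  have "evaluates (Mu (Comp pd [Comp pp [Proj 1, Proj 0]])) [encode x] (LEAST n. d x n = 0)" for x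
  proof (rule evaluates_Mu_Least[OF _ ex])
    fix n
    have "evaluates pd [prod_encode (encode x, n)] (d x n)" using pd[of x n] by simp
    then show "evaluates (Comp pd [Comp pp [Proj 1, Proj 0]]) [n, encode x] (d x n)"
      by (auto intro!: evaluates_Comp1 evaluates_Comp2[OF _ _ pp] intro: evaluates_Proj[simplified])
  qed
  then show ?thesis unfolding computable_def by auto
qed

lemma computable_encode_iff: "computable (\<lambda>x. encode (f x)) \<longleftrightarrow> computable f"
  by (simp add: computable_def)

lemma computable_decode [computable_intros]: "computable n \<Longrightarrow> computable (\<lambda>x. decode (n x))"
  by (simp add: computable_def)

section \<open>Decidable predicates, arithmetic and list operations\<close>

definition decidable :: "('a::encodable \<Rightarrow> bool) \<Rightarrow> bool" where
  "decidable P \<longleftrightarrow> computable (\<lambda>x. of_bool (P x) :: nat)"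

lemma decidable_const [computable_intros]: "decidable (\<lambda>_. c)"
  unfolding decidable_def by (rule computable_const)

lemma computable_If [computable_intros]:
  assumes "decidable P" "computable f" "computable g"
  shows "computable (\<lambda>x. if P x then f x else g x)"
proof -
  have "computable (\<lambda>x. rec_nat (g x) (\<lambda>_ _. f x) (of_bool (P x)))"
    by (intro computable_intros assms[unfolded decidable_def]
        computable_comp[OF assms(2), of "\<lambda>p. snd (snd p)"])
  moreover have "(\<lambda>x. rec_nat (g x) (\<lambda>_ _. f x) (of_bool (P x))) = (\<lambda>x. if P x then f x else g x)"
    by auto
  ultimately show ?thesis by simp
qed

lemma decidable_If [computable_intros]:
  assumes "decidable P" "decidable Q" "decidable R"
  shows "decidable (\<lambda>x. if P x then Q x else R x)"
  using computable_If[of P "\<lambda>x. of_bool (Q x) :: nat" "\<lambda>x. of_bool (R x)"] assms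
  unfolding decidable_def by (simp add: if_distrib[of of_bool])

lemma decidable_not [computable_intros]: "decidable P \<Longrightarrow> decidable (\<lambda>x. \<not> P x)"
  using decidable_If[OF _ decidable_const[of False] decidable_const[of True], of P]
  by (simp add: if_bool_eq_conj)

lemma decidable_conj [computable_intros]:
  "decidable P \<Longrightarrow> decidable Q \<Longrightarrow> decidable (\<lambda>x. P x \<and> Q x)"
  using decidable_If[OF _ _ decidable_const[of False], of P Q] by (simp add: if_bool_eq_disj)

lemma decidable_disj [computable_intros]:
  "decidable P \<Longrightarrow> decidable Q \<Longrightarrow> decidable (\<lambda>x. P x \<or> Q x)"
  using decidable_not[OF decidable_conj[OF decidable_not decidable_not]] by simp

lemma decidable_comp: "decidable P \<Longrightarrow> computable f \<Longrightarrow> decidable (\<lambda>x. P (f x))"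
  unfolding decidable_def by (rule computable_comp)

lemma computable_add [computable_intros]:
  assumes "computable m" "computable n"
  shows "computable (\<lambda>x. m x + n x :: nat)"
proof -
  have "computable (\<lambda>x. rec_nat (m x) (\<lambda>_ r. Suc r) (n x))"
    by (intro computable_intros assms)
  moreover have "rec_nat a (\<lambda>_ r. Suc r) b = a + b" for a b by (induction b) auto
  ultimately show ?thesis by simp
qed

lemma computable_mult [computable_intros]:
  assumes "computable m" "computable n"
  shows "computable (\<lambda>x. m x * n x :: nat)"
proof -
  have "computable (\<lambda>x. rec_nat 0 (\<lambda>_ r. m x + r) (n x))"
    by (intro computable_intros assms computable_comp[OF assms(1), of "\<lambda>p. snd (snd p)"])
  moreover have "rec_nat 0 (\<lambda>_ r. a + r) b = a * b" for a b :: nat by (induction b) auto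
  ultimately show ?thesis by simp
qed

lemma computable_power [computable_intros]:
  assumes "computable m" "computable n"
  shows "computable (\<lambda>x. m x ^ n x :: nat)"
proof -
  have "computable (\<lambda>x. rec_nat 1 (\<lambda>_ r. m x * r) (n x))"
    by (intro computable_intros assms computable_comp[OF assms(1), of "\<lambda>p. snd (snd p)"])
  moreover have "rec_nat 1 (\<lambda>_ r. a * r) b = a ^ b" for a b :: nat by (induction b) auto
  ultimately show ?thesis by simp
qed

lemma computable_pred:
  assumes "computable n"
  shows "computable (\<lambda>x. n x - 1 :: nat)"
proof -
  have "computable (\<lambda>x. rec_nat 0 (\<lambda>m _. m) (n x))"
    by (intro computable_intros assms)
  moreover have "rec_nat 0 (\<lambda>m _. m) k = k - 1" for k by (cases k) auto
  ultimately show ?thesis by simp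
qed

lemma computable_diff [computable_intros]:
  assumes "computable m" "computable n"
  shows "computable (\<lambda>x. m x - n x :: nat)"
proof -
  have "computable (\<lambda>x. rec_nat (m x) (\<lambda>_ r. r - 1) (n x))"
    by (intro computable_intros computable_pred assms)
  moreover have "rec_nat a (\<lambda>_ r. r - 1) b = a - b" for a b :: nat by (induction b) auto
  ultimately show ?thesis by simp
qed

lemma decidable_le [computable_intros]:
  assumes "computable m" "computable n"
  shows "decidable (\<lambda>x. m x \<le> (n x :: nat))"
proof -
  have "computable (\<lambda>x. rec_nat (1 :: nat) (\<lambda>_ _. 0) (m x - n x))"
    by (intro computable_intros assms)
  moreover have "rec_nat (1 :: nat) (\<lambda>_ _. 0) k = of_bool (k = 0)" for k by (cases k) auto
  ultimately show ?thesis by (simp add: decidable_def)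
qed

lemma decidable_less [computable_intros]:
  "computable m \<Longrightarrow> computable n \<Longrightarrow> decidable (\<lambda>x. m x < (n x :: nat))"
  using decidable_le[OF computable_Suc] by (simp add: Suc_le_eq)

lemma decidable_eq [computable_intros]:
  fixes f :: "'a::encodable \<Rightarrow> 'b::encodable"
  assumes "computable f" "computable g"
  shows "decidable (\<lambda>x. f x = g x)"
proof -
  have "decidable (\<lambda>x. encode (f x) \<le> encode (g x) \<and> encode (g x) \<le> encode (f x))"
    using assms by (intro computable_intros) (simp_all add: computable_encode_iff)
  moreover have "encode a \<le> encode b \<and> encode b \<le> encode a \<longleftrightarrow> a = b" for a b :: 'b
    by (metis encode_eq_iff le_antisym order_refl)
  ultimately show ?thesis by simp
qed

lemma decidable_all_less [computable_intros]:
  fixes P :: "'a::encodable \<Rightarrow> nat \<Rightarrow> bool"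
  assumes P: "decidable (\<lambda>p. P (fst p) (snd p))" and n: "computable n"
  shows "decidable (\<lambda>x. \<forall>i<n x. P x i)"
proof -
  have "computable (\<lambda>x. rec_nat (1 :: nat) (\<lambda>i r. if P x i then r else 0) (n x))"
    by (intro computable_intros n decidable_comp[OF P, of "\<lambda>p. (snd (snd p), fst p)", unfolded fst_conv snd_conv])
  moreover have "rec_nat (1 :: nat) (\<lambda>i r. if P x i then r else 0) k = of_bool (\<forall>i<k. P x i)"
    for x :: 'a and k
    by (induction k) (auto simp: less_Suc_eq)
  ultimately show ?thesis by (simp add: decidable_def)
qed

lemma computable_Cons [computable_intros]:
  assumes "computable f" "computable g"
  shows "computable (\<lambda>x. f x # g x)"
proof -
  have "computable (\<lambda>x. Suc (encode (f x, g x)))"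
    using assms computable_Pair by (intro computable_Suc) (simp only: computable_encode_iff)
  then show ?thesis unfolding computable_encode_iff[of "\<lambda>x. f x # g x", symmetric] by simp
qed

lemma computable_tl [computable_intros]:
  fixes f :: "'a::encodable \<Rightarrow> 'b::encodable list"
  assumes "computable f"
  shows "computable (\<lambda>x. tl (f x))"
proof -
  have "computable (\<lambda>x. encode (f x))" using assms by (simp add: computable_encode_iff)
  then have "computable (\<lambda>x. if encode (f x) = 0 then []
      else snd (decode (encode (f x) - 1) :: 'b \<times> 'b list))"
    by (intro computable_intros)
  moreover have "(if encode xs = 0 then [] else snd (decode (encode xs - 1) :: 'b \<times> 'b list)) = tl xs" for xs :: "'b list"
    by (cases xs) (auto simp: decode_prod)
  ultimately show ?thesis by (simp only:)
qed

lemma computable_hd [computable_intros]: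
  fixes f :: "'a::encodable \<Rightarrow> 'b::encodable list"
  assumes "computable f"
  shows "computable (\<lambda>x. hd (f x))"
proof -
  have "computable (\<lambda>x. encode (f x))" using assms by (simp add: computable_encode_iff)
  \<comment> \<open>\<open>hd []\<close> is an unspecified but fixed value, hence a computable
    constant.\<close>
  then have "computable (\<lambda>x. if encode (f x) = 0 then hd []
      else fst (decode (encode (f x) - 1) :: 'b \<times> 'b list))"
    by (intro computable_intros)
  moreover have "(if encode xs = 0 then hd [] else fst (decode (encode xs - 1) :: 'b \<times> 'b list)) = hd xs" for xs :: "'b list"
    by (cases xs) (auto simp: decode_prod)
  ultimately show ?thesis by (simp only:)
qed

lemma computable_drop [computable_intros]:
  assumes "computable n" "computable f"
  shows "computable (\<lambda>x. drop (n x) (f x))"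
proof -
  have "computable (\<lambda>x. rec_nat (f x) (\<lambda>_ r. tl r) (n x))"
    by (intro computable_intros assms)
  moreover have "rec_nat xs (\<lambda>_ r. tl r) k = drop k xs" for xs :: "'b list" and k
    by (induction k) (auto simp: drop_Suc tl_drop)
  ultimately show ?thesis by simp
qed

lemma computable_length [computable_intros]:
  assumes "computable f"
  shows "computable (\<lambda>x. length (f x))"
proof -
  have "computable (\<lambda>x. LEAST n. length_le (f x) n = 0)"
    if "length_le = (\<lambda>xs n. if drop n xs = [] then 0 else 1 :: nat)" for length_le :: "'b list \<Rightarrow> nat \<Rightarrow> nat"
    unfolding that
    by (intro computable_intros computable_comp[OF assms, of fst]) (auto intro: exI[of _ "length xs" for xs])
  moreover have "(LEAST n. (if drop n xs = [] then 0 else 1 :: nat) = 0) = length xs" for xs :: "'b list"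
    by (rule Least_equality) (auto split: if_splits)
  ultimately show ?thesis by simp
qed

text \<open>List elements are accessed by \<open>hd\<close> and \<open>drop\<close>, which are
  already known to be computable; this reduces quantifiers over lists to bounded
  quantifiers.\<close>

lemma Ball_set_hd_drop: "(\<forall>y\<in>set l. P y) \<longleftrightarrow> (\<forall>i<length l. P (hd (drop i l)))"
  by (metis hd_drop_conv_nth in_set_conv_nth)

lemma decidable_Ball [computable_intros]:
  assumes "decidable (\<lambda>p. P (fst p) (snd p))" "computable l"
  shows "decidable (\<lambda>x. \<forall>y\<in>set (l x). P x y)"
  unfolding Ball_set_hd_drop
  using decidable_comp[OF assms(1), of "\<lambda>p. (fst p, hd (drop (snd p) (l (fst p))))"]
  by (simp add: assms computable_intros computable_comp[OF assms(2)])

lemma decidable_Bex [computable_intros]: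
  assumes "decidable (\<lambda>p. P (fst p) (snd p))" "computable l"
  shows "decidable (\<lambda>x. \<exists>y\<in>set (l x). P x y)"
  using decidable_not[OF decidable_Ball[OF decidable_not[OF assms(1)] assms(2)]] by simp

lemma decidable_mem [computable_intros]:
  assumes "computable f" "computable l"
  shows "decidable (\<lambda>x. f x \<in> set (l x))"
proof -
  have "decidable (\<lambda>x. \<exists>y\<in>set (l x). f x = y)"
    by (intro computable_intros assms computable_comp[OF assms(1)])
  then show ?thesis by simp
qed

lemma prefix_hd_drop:
  "prefix xs ys \<longleftrightarrow> length xs \<le> length ys \<and> (\<forall>i<length xs. hd (drop i xs) = hd (drop i ys))"
proof (induction xs arbitrary: ys)
  case (Cons x xs)
  show ?case
  proof (cases ys)
    case (Cons y zs)
    then show ?thesis using Cons.IH[of zs] by (auto simp: less_Suc_eq_0_disj all_conj_distrib)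
  qed auto
qed auto

lemma decidable_prefix [computable_intros]:
  assumes "computable f" "computable g"
  shows "decidable (\<lambda>x. prefix (f x) (g x))"
  unfolding prefix_hd_drop
  by (intro computable_intros assms computable_comp[OF assms(1), of fst] computable_comp[OF assms(2), of fst])

section \<open>Semidecidable relations\<close>

text \<open>These are the Sigma-1 relations. They are closed under existential and bounded universal
  quantifiers but not under negation, so all certificates below use semidecidable facts only
  positively.\<close>

definition semidecidable :: "('a::encodable \<Rightarrow> bool) \<Rightarrow> bool" where
  "semidecidable P \<longleftrightarrow> (\<exists>D :: 'a \<times> nat \<Rightarrow> bool. decidable D \<and> (\<forall>a. P a \<longleftrightarrow> (\<exists>t. D (a, t))))"

named_theorems semidecidable_intros

lemma semidecidableI:
  assumes "decidable (\<lambda>p. D (fst p) (snd p))" "\<And>a. P a \<longleftrightarrow> (\<exists>t :: nat. D a t)"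
  shows "semidecidable P"
  unfolding semidecidable_def using assms by (intro exI[of _ "\<lambda>p. D (fst p) (snd p)"]) simp

lemma semidecidableE:
  assumes "semidecidable P"
  obtains D where "decidable (\<lambda>p. D (fst p) (snd p))" "\<forall>a. P a \<longleftrightarrow> (\<exists>t :: nat. D a t)"
proof -
  obtain D where "decidable D" "\<forall>a. P a \<longleftrightarrow> (\<exists>t :: nat. D (a, t))"
    using assms unfolding semidecidable_def by blast
  then show ?thesis using that[of "\<lambda>a t. D (a, t)"] by simp
qed

lemma semidecidable_comp:
  assumes "semidecidable P" "computable f"
  shows "semidecidable (\<lambda>x. P (f x))"
proof -
  obtain D where D: "decidable (\<lambda>p. D (fst p) (snd p))" "\<forall>a. P a \<longleftrightarrow> (\<exists>t :: nat. D a t)"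
    using assms(1) by (rule semidecidableE)
  show ?thesis
  proof (rule semidecidableI)
    show "decidable (\<lambda>p. D (f (fst p)) (snd p))"
      by (rule decidable_comp[OF D(1), of "\<lambda>p. (f (fst p), snd p)", unfolded fst_conv snd_conv])
        (intro computable_intros computable_comp[OF assms(2)])
  qed (use D in simp)
qed

lemma semidecidable_decidable: "decidable P \<Longrightarrow> semidecidable P"
  by (rule semidecidableI[where D = "\<lambda>a _. P a"])
    (simp_all add: decidable_comp[of P fst] computable_intros)

lemma semidecidable_conj [semidecidable_intros]:
  assumes "semidecidable P" "semidecidable Q"
  shows "semidecidable (\<lambda>x. P x \<and> Q x)"
proof -
  obtain D where D: "decidable (\<lambda>p. D (fst p) (snd p))" "\<forall>a. P a \<longleftrightarrow> (\<exists>t :: nat. D a t)"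
    using assms(1) by (rule semidecidableE)
  obtain E where E: "decidable (\<lambda>p. E (fst p) (snd p))" "\<forall>a. Q a \<longleftrightarrow> (\<exists>t :: nat. E a t)"
    using assms(2) by (rule semidecidableE)
  show ?thesis
  proof (rule semidecidableI)
    show "decidable (\<lambda>p. D (fst p) (fst (decode (snd p) :: nat \<times> nat))
        \<and> E (fst p) (snd (decode (snd p) :: nat \<times> nat)))"
      by (intro computable_intros
          decidable_comp[OF D(1), of "\<lambda>p. (fst p, fst (decode (snd p) :: nat \<times> nat))", unfolded fst_conv snd_conv]
          decidable_comp[OF E(1), of "\<lambda>p. (fst p, snd (decode (snd p) :: nat \<times> nat))", unfolded fst_conv snd_conv])
    show "P x \<and> Q x \<longleftrightarrow> (\<exists>t. D x (fst (decode t :: nat \<times> nat)) \<and> E x (snd (decode t :: nat \<times> nat)))" for x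
      using D(2) E(2) by (metis decode_encode fst_conv snd_conv)
  qed
qed

lemma semidecidable_Ex [semidecidable_intros]:
  fixes P :: "'a::encodable \<Rightarrow> 'b::encodable \<Rightarrow> bool"
  assumes "semidecidable (\<lambda>p. P (fst p) (snd p))"
  shows "semidecidable (\<lambda>x. \<exists>y. P x y)"
proof -
  obtain D where D: "decidable (\<lambda>p. D (fst p) (snd p))"
    "\<forall>p :: 'a \<times> 'b. P (fst p) (snd p) \<longleftrightarrow> (\<exists>t :: nat. D p t)"
    using assms by (rule semidecidableE)
  show ?thesis
  proof (rule semidecidableI)
    show "decidable (\<lambda>p. D (fst p, fst (decode (snd p) :: 'b \<times> nat)) (snd (decode (snd p) :: 'b \<times> nat)))"
      by (intro computable_intros decidable_comp[OF D(1), of "\<lambda>p. ((fst p, fst (decode (snd p) :: 'b \<times> nat)),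
          snd (decode (snd p) :: 'b \<times> nat))", unfolded fst_conv snd_conv])
    show "(\<exists>y. P x y) \<longleftrightarrow> (\<exists>t. D (x, fst (decode t :: 'b \<times> nat)) (snd (decode t :: 'b \<times> nat)))" for x
    proof -
      have "P x y \<longleftrightarrow> (\<exists>t. D (x, y) t)" for y using D(2)[rule_format, of "(x, y)"] by simp
      then show ?thesis by (metis decode_encode fst_conv snd_conv)
    qed
  qed
qed

lemma semidecidable_disj [semidecidable_intros]:
  assumes "semidecidable P" "semidecidable Q"
  shows "semidecidable (\<lambda>x. P x \<or> Q x)"
proof -
  obtain D where D: "decidable (\<lambda>p. D (fst p) (snd p))" "\<forall>a. P a \<longleftrightarrow> (\<exists>t :: nat. D a t)"
    using assms(1) by (rule semidecidableE)
  obtain E where E: "decidable (\<lambda>p. E (fst p) (snd p))" "\<forall>a. Q a \<longleftrightarrow> (\<exists>t :: nat. E a t)"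
    using assms(2) by (rule semidecidableE)
  show ?thesis
    by (rule semidecidableI[OF decidable_disj[OF D(1) E(1)]]) (auto simp: D(2) E(2))
qed

text \<open>The witnesses for the finitely many instances are bounded by a common number.\<close>

lemma semidecidable_all_less [semidecidable_intros]:
  fixes P :: "'a::encodable \<Rightarrow> nat \<Rightarrow> bool"
  assumes "semidecidable (\<lambda>p. P (fst p) (snd p))" and n: "computable n"
  shows "semidecidable (\<lambda>x. \<forall>i<n x. P x i)"
proof -
  obtain D where D: "decidable (\<lambda>p. D (fst p) (snd p))"
    "\<forall>p. P (fst p) (snd p) \<longleftrightarrow> (\<exists>t :: nat. D p t)"
    using assms(1) by (rule semidecidableE)
  show ?thesis
  proof (rule semidecidableI)
    show "decidable (\<lambda>p. \<forall>i<n (fst p). \<not> (\<forall>t<snd p. \<not> D (fst p, i) t))"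
      by (intro computable_intros computable_comp[OF n]
          decidable_comp[OF D(1), of "\<lambda>p. ((fst (fst (fst p)), snd (fst p)), snd p)", unfolded fst_conv snd_conv])
    show "(\<forall>i<n x. P x i) \<longleftrightarrow> (\<exists>b. \<forall>i<n x. \<not> (\<forall>t<b. \<not> D (x, i) t))" for x
    proof
      have P: "P x i \<longleftrightarrow> (\<exists>t. D (x, i) t)" for i using D(2)[rule_format, of "(x, i)"] by simp
      show "\<forall>i<n x. P x i" if "\<exists>b. \<forall>i<n x. \<not> (\<forall>t<b. \<not> D (x, i) t)"
        using that unfolding P by blast
      assume "\<forall>i<n x. P x i"
      then have "\<forall>i\<in>{..<n x}. \<exists>t. D (x, i) t" by (simp add: P)
      from bchoice[OF this] obtain t where t: "\<forall>i\<in>{..<n x}. D (x, i) (t i)" by blast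
      have "t i < Suc (\<Sum>i<n x. t i)" if "i < n x" for i
        using member_le_sum[of i "{..<n x}" t] that by simp
      with t show "\<exists>b. \<forall>i<n x. \<not> (\<forall>t<b. \<not> D (x, i) t)" by blast
    qed
  qed
qed

lemma semidecidable_imp [semidecidable_intros]:
  "decidable P \<Longrightarrow> semidecidable Q \<Longrightarrow> semidecidable (\<lambda>x. P x \<longrightarrow> Q x)"
  using semidecidable_disj[OF semidecidable_decidable[OF decidable_not], of P Q] by simp

lemma semidecidable_Ball [semidecidable_intros]:
  assumes "semidecidable (\<lambda>p. P (fst p) (snd p))" "computable l"
  shows "semidecidable (\<lambda>x. \<forall>y\<in>set (l x). P x y)"
  unfolding Ball_set_hd_drop
  by (intro semidecidable_all_less computable_length assms(2)
      semidecidable_comp[OF assms(1), of "\<lambda>p. (fst p, hd (drop (snd p) (l (fst p))))", unfolded fst_conv snd_conv]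
      computable_intros computable_comp[OF assms(2)])

lemmas [semidecidable_intros] =
  semidecidable_decidable[OF decidable_const]
  semidecidable_decidable[OF decidable_not]
  semidecidable_decidable[OF decidable_le]
  semidecidable_decidable[OF decidable_less]
  semidecidable_decidable[OF decidable_eq]
  semidecidable_decidable[OF decidable_mem]
  semidecidable_decidable[OF decidable_prefix]

text \<open>Uniformisation of a Sigma-1 relation by a search through coded pairs of a candidate and
  a witness of its correctness. It supplies the computable choices in
  \<open>effective_rate\<close>.\<close>

lemma semidecidable_selection:
  fixes P :: "'a::encodable \<Rightarrow> 'b::encodable \<Rightarrow> bool"
  assumes "semidecidable (\<lambda>p. P (fst p) (snd p))" and "\<And>a. \<exists>b. P a b"
  obtains h where "computable h" "\<And>a. P a (h a)"
proof -
  obtain D where D: "decidable (\<lambda>p. D (fst p) (snd p))"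
    "\<forall>p :: 'a \<times> 'b. P (fst p) (snd p) \<longleftrightarrow> (\<exists>t :: nat. D p t)"
    using assms(1) by (rule semidecidableE)
  define d where "d a n = (if D (a, fst (decode n :: 'b \<times> nat)) (snd (decode n :: 'b \<times> nat)) then 0 else 1 :: nat)"
    for a n
  have ex: "\<exists>n. d a n = 0" for a
  proof -
    obtain b where "P a b" using assms(2) by blast
    then obtain t where "D (a, b) t" using D(2)[rule_format, of "(a, b)"] by auto
    then show ?thesis by (intro exI[of _ "encode (b, t)"]) (simp only: d_def decode_encode fst_conv snd_conv if_True)
  qed
  have "computable (\<lambda>a. LEAST n. d a n = 0)"
  proof (rule computable_Least[OF _ ex])
    show "computable (\<lambda>p. d (fst p) (snd p))"
      unfolding d_def
      by (intro computable_intros decidable_comp[OF D(1), of "\<lambda>p. ((fst p, fst (decode (snd p) :: 'b \<times> nat)),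
          snd (decode (snd p) :: 'b \<times> nat))", unfolded fst_conv snd_conv])
  qed
  then have "computable (\<lambda>a. fst (decode (LEAST n. d a n = 0) :: 'b \<times> nat))"
    by (rule computable_fst[OF computable_decode])
  moreover have "P a (fst (decode (LEAST n. d a n = 0) :: 'b \<times> nat))" for a
  proof -
    have "P a (fst (decode n :: 'b \<times> nat))" if "d a n = 0" for n
      using that D(2)[rule_format, of "(a, fst (decode n :: 'b \<times> nat))"]
      by (auto simp: d_def split: if_splits)
    then show ?thesis using LeastI_ex[OF ex] by blast
  qed
  ultimately show ?thesis using that by blast
qed

text \<open>Unbounded search for a witness halts exactly on the codes of elements.\<close>

lemma recursively_enumerable_semidecidable:
  assumes "semidecidable P"
  shows "recursively_enumerable (encode ` Collect P)"
proof -
  obtain D where D: "decidable (\<lambda>p. D (fst p) (snd p))" "\<forall>a. P a \<longleftrightarrow> (\<exists>t :: nat. D a t)"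
    using assms by (rule semidecidableE)
  have "computable (\<lambda>p. if D (fst p) (snd p) then 0 else 1 :: nat)"
    by (intro computable_intros D)
  then obtain pd pp where pd: "\<And>x n. evaluates pd [encode (x, n)] (if D x n then 0 else 1)"
    and pp: "\<And>x y. evaluates pp [x, y] (prod_encode (x, y))"
    using computes2_prod_encode unfolding computable_def computes2_def
    by (metis encode_nat_def fst_conv snd_conv)
  let ?q = "Comp pd [Comp pp [Proj 1, Proj 0]]"
  have q: "evaluates ?q [n, encode x] (if D x n then 0 else 1)" for n x
  proof -
    have "evaluates pd [prod_encode (encode x, n)] (if D x n then 0 else 1)"
      using pd[of x n] by simp
    then show ?thesis
      using evaluates_Comp1[OF evaluates_Comp2[OF evaluates_Proj(2,1) pp]] by blast
  qed
  have "P x \<longleftrightarrow> (\<exists>y. evaluates (Mu ?q) [encode x] y)" for x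
  proof
    assume "P x"
    then have "evaluates (Mu ?q) [encode x] (LEAST n. (if D x n then 0 else 1 :: nat) = 0)"
      using D(2) by (intro evaluates_Mu_Least[OF q]) auto
    then show "\<exists>y. evaluates (Mu ?q) [encode x] y" by blast
  next
    assume "\<exists>y. evaluates (Mu ?q) [encode x] y"
    then obtain n where "evaluates (Mu ?q) [encode x] n" by blast
    then have "evaluates ?q [n, encode x] 0" by cases auto
    then have "(if D x n then 0 else 1 :: nat) = 0" using q evaluates_deterministic by blast
    then show "P x" using D(2) by (auto split: if_splits)
  qed
  then have "encode ` Collect P = {n. \<exists>y. evaluates (Mu ?q) [n] y}"
    by (auto simp: image_iff) (metis encode_decode)
  then show ?thesis unfolding recursively_enumerable_def by blast
qed

text \<open>The intermediate values are only enumerable, so primitive recursion cannot compute them.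
  Instead a finite list of all of them is guessed and each of its steps is checked.\<close>

lemma semidecidable_rec:
  fixes P :: "'a::encodable \<Rightarrow> nat \<Rightarrow> 'b::encodable \<Rightarrow> bool"
  assumes A: "semidecidable (\<lambda>p. A (fst p) (snd p))"
    and R: "semidecidable (\<lambda>p. R (fst p) (fst (snd p)) (fst (snd (snd p))) (snd (snd (snd p))))"
    and P_0: "\<And>a y. P a 0 y \<longleftrightarrow> A a y"
    and P_Suc: "\<And>a n y. P a (Suc n) y \<longleftrightarrow> (\<exists>z. P a n z \<and> R a n z y)"
  shows "semidecidable (\<lambda>p. P (fst p) (fst (snd p)) (snd (snd p)))"
proof -
  have "P a n y \<longleftrightarrow> (\<exists>h. A a (h 0) \<and> (\<forall>i<n. R a i (h i) (h (Suc i))) \<and> h n = y)" for a n y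
  proof (induction n arbitrary: y)
    case 0
    then show ?case by (auto simp: P_0 intro: exI[of _ "\<lambda>_. y"])
  next
    case (Suc n)
    show ?case
    proof
      assume "P a (Suc n) y"
      then obtain z where "P a n z" and z: "R a n z y" using P_Suc by blast
      then obtain h where "A a (h 0)" "\<forall>i<n. R a i (h i) (h (Suc i))" "h n = z" using Suc by blast
      with z show "\<exists>h. A a (h 0) \<and> (\<forall>i<Suc n. R a i (h i) (h (Suc i))) \<and> h (Suc n) = y"
        by (intro exI[of _ "h(Suc n := y)"]) (auto simp: less_Suc_eq)
    next
      assume "\<exists>h. A a (h 0) \<and> (\<forall>i<Suc n. R a i (h i) (h (Suc i))) \<and> h (Suc n) = y"
      then obtain h where h: "A a (h 0)" "\<forall>i<n. R a i (h i) (h (Suc i))" "R a n (h n) y"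
        by (auto simp: less_Suc_eq)
      then have "P a n (h n)" using Suc by blast
      with h(3) show "P a (Suc n) y" using P_Suc by blast
    qed
  qed
  also have "(\<exists>h. A a (h 0) \<and> (\<forall>i<n. R a i (h i) (h (Suc i))) \<and> h n = y)
      \<longleftrightarrow> (\<exists>l. A a (hd l) \<and> (\<forall>i<n. R a i (hd (drop i l)) (hd (drop (Suc i) l))) \<and> hd (drop n l) = y)"
    (is "?L \<longleftrightarrow> ?R") for a n y
  proof
    assume ?L
    then obtain h where h: "A a (h 0)" "\<forall>i<n. R a i (h i) (h (Suc i))" "h n = y" by blast
    have "hd (drop i (map h [0..<Suc n])) = h i" if "i \<le> n" for i
      using that by (subst hd_drop_conv_nth) (auto simp del: upt_Suc)
    from this[of 0] this show ?R using h by (intro exI[of _ "map h [0..<Suc n]"]) (simp del: upt_Suc)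
  next
    assume ?R
    then obtain l where "A a (hd l)" "\<forall>i<n. R a i (hd (drop i l)) (hd (drop (Suc i) l))" "hd (drop n l) = y"
      by blast
    then show ?L by (intro exI[of _ "\<lambda>i. hd (drop i l)"]) simp
  qed
  finally show ?thesis
    by (simp only:) (intro semidecidable_intros computable_intros
      semidecidable_comp[OF A, of "\<lambda>p. (fst (fst p), hd (snd p))", unfolded fst_conv snd_conv]
      semidecidable_comp[OF R, of "\<lambda>p. (fst (fst (fst p)), snd p, hd (drop (snd p) (snd (fst p))),
        hd (drop (Suc (snd p)) (snd (fst p))))", unfolded fst_conv snd_conv])
qed

section \<open>The graphs of programs\<close>

lemma encode_nat_list: "encode (xs :: nat list) = list_encode xs"
  by (simp add: encode_list_def map_idI)

lemma evaluates_PrimRec_iff: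
  "evaluates (PrimRec f g) (0 # xs) y \<longleftrightarrow> evaluates f xs y"
  "evaluates (PrimRec f g) (Suc n # xs) y
    \<longleftrightarrow> (\<exists>z. evaluates (PrimRec f g) (n # xs) z \<and> evaluates g (n # z # xs) y)"
  by (auto elim: evaluates.cases intro: evaluates.PrimRec_0 evaluates.PrimRec_Suc)

lemma evaluates_Mu_iff:
  "evaluates (Mu f) xs n \<longleftrightarrow> evaluates f (n # xs) 0 \<and> (\<forall>m<n. \<exists>y. evaluates f (m # xs) (Suc y))"
  by (auto elim: evaluates.cases intro: evaluates.Mu)

lemma evaluates_Comp_iff:
  "evaluates (Comp f gs) xs z \<longleftrightarrow> (\<exists>ys. list_all2 (\<lambda>g y. evaluates g xs y) gs ys \<and> evaluates f ys z)"
  by (auto elim: evaluates.cases intro: evaluates.Comp)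

text \<open>The program \<open>q\<close> is fixed, so induction on its structure takes the place of
  a universal machine. Primitive recursion is treated by lists of intermediate values, minimisation
  by a bounded universal quantifier.\<close>

lemma semidecidable_evaluates:
  "semidecidable (\<lambda>p :: nat list \<times> nat. evaluates q (fst p) (snd p))"
proof (induction q)
  case Zero
  have "evaluates Zero xs y \<longleftrightarrow> y = 0" for xs y
    by (auto elim: evaluates.cases intro: evaluates.Zero)
  then show ?case by (auto intro!: semidecidable_intros computable_intros)
next
  case Succ
  have "evaluates Succ xs y \<longleftrightarrow> xs = [hd xs] \<and> y = Suc (hd xs)" for xs y
    by (auto elim: evaluates.cases intro: evaluates.Succ) (metis evaluates.Succ)
  then show ?case by (auto intro!: semidecidable_intros computable_intros)
next
  case (Proj i)
  have "evaluates (Proj i) xs y \<longleftrightarrow> i < length xs \<and> y = hd (drop i xs)" for xs y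
    by (auto elim: evaluates.cases simp: hd_drop_conv_nth intro: evaluates.Proj)
  then show ?case by (auto intro!: semidecidable_intros computable_intros)
next
  case (Comp f gs)
  have "semidecidable (\<lambda>p :: nat list \<times> nat list. list_all2 (\<lambda>g y. evaluates g (fst p) y) gs (snd p))"
    using Comp.IH(2)
  proof (induction gs)
    case Nil
    then show ?case by (auto intro!: semidecidable_intros computable_intros)
  next
    case (Cons g gs)
    have eq: "list_all2 (\<lambda>g y. evaluates g xs y) (g # gs) ys \<longleftrightarrow> ys \<noteq> [] \<and> evaluates g xs (hd ys) \<and>
        list_all2 (\<lambda>g y. evaluates g xs y) gs (tl ys)" for xs ys
      by (cases ys) auto
    have "semidecidable (\<lambda>p. evaluates g (fst p) (snd p))"
      by (rule Cons.prems) simp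
    note s1 = semidecidable_comp[OF this, of "\<lambda>p. (fst p, hd (snd p))", unfolded fst_conv snd_conv]
    have "semidecidable (\<lambda>p :: nat list \<times> nat list.
        list_all2 (\<lambda>g y. evaluates g (fst p) y) gs (snd p))"
      by (rule Cons.IH, rule Cons.prems) simp
    note s2 = semidecidable_comp[OF this, of "\<lambda>p. (fst p, tl (snd p))", unfolded fst_conv snd_conv]
    show ?case unfolding eq by (intro semidecidable_intros s1 s2 computable_intros)
  qed
  note gs = semidecidable_comp[OF this, of "\<lambda>p. (fst (fst p), snd p)", unfolded fst_conv snd_conv]
  show ?case
    unfolding evaluates_Comp_iff
    by (intro semidecidable_intros gs computable_intros
        semidecidable_comp[OF Comp.IH(1), of "\<lambda>p. (snd p, snd (fst p))", unfolded fst_conv snd_conv])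
next
  case (PrimRec f g)
  have "semidecidable (\<lambda>p :: nat list \<times> nat \<times> nat.
      evaluates (PrimRec f g) (fst (snd p) # fst p) (snd (snd p)))"
    by (rule semidecidable_rec[OF PrimRec.IH(1) _ evaluates_PrimRec_iff])
      (intro computable_intros semidecidable_comp[OF PrimRec.IH(2), of
        "\<lambda>p. (fst (snd p) # fst (snd (snd p)) # fst p, snd (snd (snd p)))", unfolded fst_conv snd_conv])
  from semidecidable_comp[OF this, of "\<lambda>p. (tl (fst p), hd (fst p), snd p)"]
  have *: "semidecidable (\<lambda>p :: nat list \<times> nat.
      evaluates (PrimRec f g) (hd (fst p) # tl (fst p)) (snd p))"
    by (simp add: computable_intros)
  have "evaluates (PrimRec f g) xs y \<longleftrightarrow> xs \<noteq> [] \<and> evaluates (PrimRec f g) (hd xs # tl xs) y" for xs y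
  proof -
    have "\<not> evaluates (PrimRec f g) [] y" by (rule notI) (erule evaluates.cases; simp)
    then show ?thesis by (cases xs) simp_all
  qed
  then have eq: "(\<lambda>p :: nat list \<times> nat. evaluates (PrimRec f g) (fst p) (snd p))
      = (\<lambda>p. fst p \<noteq> [] \<and> evaluates (PrimRec f g) (hd (fst p) # tl (fst p)) (snd p))"
    by (intro ext)
  show ?case by (subst eq) (intro semidecidable_intros computable_intros *)
next
  case (Mu f)
  show ?case
    unfolding evaluates_Mu_iff
    by (intro semidecidable_intros computable_intros
        semidecidable_comp[OF Mu.IH, of "\<lambda>p. (snd p # fst p, 0)", unfolded fst_conv snd_conv]
        semidecidable_comp[OF Mu.IH, of "\<lambda>p. (snd (fst p) # fst (fst (fst p)), Suc (snd p))", unfolded fst_conv snd_conv])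
qed

lemma semidecidable_recursively_enumerable:
  assumes "recursively_enumerable A"
  shows "semidecidable (\<lambda>a. encode a \<in> A)"
proof -
  obtain q where A: "A = {n. \<exists>y. evaluates q [n] y}"
    using assms unfolding recursively_enumerable_def by blast
  show ?thesis
    unfolding A mem_Collect_eq
    by (intro semidecidable_intros computable_intros
        semidecidable_comp[OF semidecidable_evaluates, of "\<lambda>p. ([encode (fst p)], snd p)", unfolded fst_conv snd_conv])
      (simp add: computable_encode_iff computable_fst computable_ident)
qed

section \<open>The maximal ergodic inequality and convergence in probability\<close>

definition birkhoff_sum :: "('a \<Rightarrow> 'a) \<Rightarrow> ('a \<Rightarrow> real) \<Rightarrow> nat \<Rightarrow> 'a \<Rightarrow> real" where
  "birkhoff_sum T g n x = (\<Sum>k<n. g ((T ^^ k) x))"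

lemma birkhoff_sum_0 [simp]: "birkhoff_sum T g 0 x = 0"
  by (simp add: birkhoff_sum_def)

lemma birkhoff_sum_Suc: "birkhoff_sum T g (Suc n) x = g x + birkhoff_sum T g n (T x)"
  unfolding birkhoff_sum_def
  by (subst sum.lessThan_Suc_shift) (simp add: funpow_Suc_right del: funpow.simps)

lemma birkhoff_sum_diff_const:
  "birkhoff_sum T (\<lambda>x. g x - c) n x = birkhoff_sum T g n x - real n * c"
  by (simp add: birkhoff_sum_def sum_subtractf)

lemma birkhoff_sum_uminus: "birkhoff_sum T (\<lambda>x. - g x) n x = - birkhoff_sum T g n x"
  by (simp add: birkhoff_sum_def sum_negf)

lemma abs_birkhoff_sum_le: "\<bar>birkhoff_sum T g n x\<bar> \<le> birkhoff_sum T (\<lambda>x. \<bar>g x\<bar>) n x"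
  by (simp add: birkhoff_sum_def)

lemma birkhoff_sum_bound:
  assumes "\<And>x. \<bar>g x\<bar> \<le> K"
  shows "\<bar>birkhoff_sum T g n x\<bar> \<le> real n * K"
  using sum_norm_bound[of "{..<n}" "\<lambda>k. g ((T ^^ k) x)" K] assms by (simp add: birkhoff_sum_def)

text \<open>The maximum of the Birkhoff sums of length at most \<open>n\<close>, including the empty one.\<close>

primrec max_sum :: "('a \<Rightarrow> 'a) \<Rightarrow> ('a \<Rightarrow> real) \<Rightarrow> nat \<Rightarrow> 'a \<Rightarrow> real" where
  "max_sum T g 0 = (\<lambda>x. 0)"
| "max_sum T g (Suc n) = (\<lambda>x. max 0 (g x + max_sum T g n (T x)))"

lemma max_sum_nonneg: "0 \<le> max_sum T g n x"
  by (cases n) auto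

lemma max_sum_mono_Suc: "max_sum T g n x \<le> max_sum T g (Suc n) x"
proof (induction n arbitrary: x)
  case (Suc n)
  have "max 0 (g x + max_sum T g n (T x)) \<le> max 0 (g x + max_sum T g (Suc n) (T x))"
    by (intro max.mono add_left_mono Suc order_refl)
  then show ?case by (simp only: max_sum.simps)
qed simp

lemma max_sum_mono: "m \<le> n \<Longrightarrow> max_sum T g m x \<le> max_sum T g n x"
  using max_sum_mono_Suc by (rule lift_Suc_mono_le[of "\<lambda>n. max_sum T g n x"])

lemma birkhoff_sum_le_max_sum: "birkhoff_sum T g n x \<le> max_sum T g n x"
  by (induction n arbitrary: x) (auto simp: birkhoff_sum_Suc intro: max.coboundedI2)

lemma max_sum_bound:
  assumes "\<And>x. \<bar>g x\<bar> \<le> K"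
  shows "\<bar>max_sum T g n x\<bar> \<le> real n * K"
proof (induction n arbitrary: x)
  case (Suc n)
  have "real (Suc n) * K = K + real n * K" by (simp add: distrib_right)
  then show ?case using Suc[of "T x"] assms[of x] unfolding max_sum.simps by linarith
qed simp

section \<open>Maximal inequalities for measure preserving maps\<close>

locale measure_preserving_system = prob_space M for M :: "'a measure" +
  fixes T :: "'a \<Rightarrow> 'a"
  assumes preserves: "preserves_measure M T"
begin

lemma measurable_T [measurable]: "T \<in> measurable M M"
  using preserves by (simp add: preserves_measure_def)

lemma distr_T: "distr M M T = M"
proof (rule measure_eqI)
  show "emeasure (distr M M T) A = emeasure M A" if "A \<in> sets (distr M M T)" for A
    using that preserves by (simp add: emeasure_distr preserves_measure_def)
qed simp

lemma integral_comp_T: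
  fixes g :: "'a \<Rightarrow> real"
  assumes "g \<in> borel_measurable M"
  shows "(\<integral>x. g (T x) \<partial>M) = (\<integral>x. g x \<partial>M)"
  using integral_distr[OF measurable_T assms] distr_T by simp

lemma borel_measurable_birkhoff_sum [measurable]:
  assumes [measurable]: "g \<in> borel_measurable M"
  shows "birkhoff_sum T g n \<in> borel_measurable M"
  unfolding birkhoff_sum_def[abs_def] by measurable

lemma borel_measurable_max_sum [measurable]:
  assumes [measurable]: "g \<in> borel_measurable M"
  shows "max_sum T g n \<in> borel_measurable M"
  by (induction n) (simp_all, measurable)

lemma integral_birkhoff_sum:
  assumes [measurable]: "g \<in> borel_measurable M" and K: "\<And>x. \<bar>g x\<bar> \<le> K"
  shows "(\<integral>x. birkhoff_sum T g n x \<partial>M) = real n * (\<integral>x. g x \<partial>M)"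
proof (induction n)
  case (Suc n)
  have "(\<integral>x. birkhoff_sum T g (Suc n) x \<partial>M) = (\<integral>x. g x + birkhoff_sum T g n (T x) \<partial>M)"
    by (simp add: birkhoff_sum_Suc)
  also have "\<dots> = (\<integral>x. g x \<partial>M) + (\<integral>x. birkhoff_sum T g n (T x) \<partial>M)"
  proof (rule Bochner_Integration.integral_add)
    show "integrable M g" by (rule integrable_const_bound[where B = K]) (auto simp: K)
    show "integrable M (\<lambda>x. birkhoff_sum T g n (T x))"
      by (rule integrable_const_bound[where B = "real n * K"]) (auto simp: K birkhoff_sum_bound)
  qed
  also have "\<dots> = real (Suc n) * (\<integral>x. g x \<partial>M)"
    using Suc by (simp add: integral_comp_T[of "birkhoff_sum T g n"] algebra_simps)
  finally show ?case .
qed simp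

text \<open>Garsia's argument: where the maximum \<open>F\<close> is positive, \<open>F \<le> g + F \<circ> T\<close>.\<close>

lemma maximal_ergodic:
  assumes [measurable]: "g \<in> borel_measurable M" and K: "\<And>x. \<bar>g x\<bar> \<le> K"
  shows "0 \<le> (\<integral>x. g x * indicator {x \<in> space M. 0 < max_sum T g n x} x \<partial>M)"
proof -
  let ?F = "max_sum T g n" and ?E = "{x \<in> space M. 0 < max_sum T g n x}"
  have K0: "0 \<le> K" using K[of undefined] by linarith
  have int: "integrable M ?F" "integrable M (\<lambda>x. ?F (T x))"
    by (auto intro!: integrable_const_bound[where B = "real n * K"] simp: max_sum_bound K)
  have intg: "integrable M (\<lambda>x. g x * indicator ?E x)"
    by (rule integrable_const_bound[where B = K]) (auto simp: K K0 abs_mult split: split_indicator)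
  have "?F x - ?F (T x) \<le> g x * indicator ?E x" if "x \<in> space M" for x
  proof (cases "0 < ?F x")
    case True
    then obtain m where m: "n = Suc m" by (cases n) auto
    \<comment> \<open>A positive maximum comes from a nonempty sum; without its first term, a sum of
      length at most \<open>m\<close> starting at \<open>T x\<close> remains.\<close>
    then have "?F x = g x + max_sum T g m (T x)" using True by (auto simp: max_def split: if_splits)
    then show ?thesis using True that max_sum_mono_Suc[of T g m "T x"] m by simp
  next
    case False
    then show ?thesis using max_sum_nonneg[of T g n x] max_sum_nonneg[of T g n "T x"] by simp
  qed
  then have "(\<integral>x. ?F x - ?F (T x) \<partial>M) \<le> (\<integral>x. g x * indicator ?E x \<partial>M)"
    using int intg by (intro integral_mono) auto
  moreover have "(\<integral>x. ?F x - ?F (T x) \<partial>M) = 0"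
    using int by (simp add: integral_comp_T[of ?F])
  ultimately show ?thesis by simp
qed

text \<open>This weak-type bound is \<open>maximal_ergodic\<close> for
  \<open>\<bar>g\<bar> - l\<close>, whose Birkhoff sum is positive wherever that of \<open>g\<close>
  exceeds \<open>n * l\<close> in absolute value. The right-hand side does not depend on
  \<open>N\<close>.\<close>

lemma maximal_inequality:
  assumes [measurable]: "g \<in> borel_measurable M" and K: "\<And>x. \<bar>g x\<bar> \<le> K" and "0 < l"
  shows "l * prob {x \<in> space M. \<exists>n\<in>{1..N}. real n * l < \<bar>birkhoff_sum T g n x\<bar>} \<le> (\<integral>x. \<bar>g x\<bar> \<partial>M)"
proof -
  let ?g = "\<lambda>x. \<bar>g x\<bar> - l"
  let ?E = "{x \<in> space M. 0 < max_sum T ?g N x}"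
  have "?E \<in> events" by measurable
  have gl: "\<bar>?g x\<bar> \<le> K + l" for x using K[of x] assms(3) by linarith
  have "0 < max_sum T ?g N x" if "n \<in> {1..N}" "real n * l < \<bar>birkhoff_sum T g n x\<bar>" for n x
  proof -
    have "0 < birkhoff_sum T ?g n x"
      using that(2) abs_birkhoff_sum_le[of T g n x] by (simp add: birkhoff_sum_diff_const)
    also have "\<dots> \<le> max_sum T ?g n x" by (rule birkhoff_sum_le_max_sum)
    also have "\<dots> \<le> max_sum T ?g N x" using that(1) by (intro max_sum_mono) auto
    finally show ?thesis .
  qed
  then have "prob {x \<in> space M. \<exists>n\<in>{1..N}. real n * l < \<bar>birkhoff_sum T g n x\<bar>} \<le> prob ?E"
    by (intro finite_measure_mono) (auto, measurable)
  then have "l * prob {x \<in> space M. \<exists>n\<in>{1..N}. real n * l < \<bar>birkhoff_sum T g n x\<bar>} \<le> l * prob ?E"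
    using assms(3) by simp
  also have "\<dots> \<le> (\<integral>x. \<bar>g x\<bar> * indicator ?E x \<partial>M)"
  proof -
    have i: "integrable M (\<lambda>x. \<bar>g x\<bar> * indicator ?E x)"
      by (rule integrable_const_bound[where B = K])
        (use K order_trans[OF abs_ge_zero K] in \<open>auto split: split_indicator\<close>)
    have "0 \<le> (\<integral>x. ?g x * indicator ?E x \<partial>M)"
      by (rule maximal_ergodic[OF _ gl]) measurable
    also have "\<dots> = (\<integral>x. \<bar>g x\<bar> * indicator ?E x - l * indicator ?E x \<partial>M)"
      by (simp add: left_diff_distrib)
    also have "\<dots> = (\<integral>x. \<bar>g x\<bar> * indicator ?E x \<partial>M) - l * prob ?E"
      using i by (subst Bochner_Integration.integral_diff) (auto simp: emeasure_eq_measure)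
    finally show ?thesis by simp
  qed
  also have "\<dots> \<le> (\<integral>x. \<bar>g x\<bar> \<partial>M)"
    by (intro integral_mono integrable_const_bound[where B = K])
      (use K order_trans[OF abs_ge_zero K] in \<open>auto split: split_indicator\<close>)
  finally show ?thesis .
qed

end

text \<open>The tolerances \<open>1 / real (Suc j)\<close> keep all quantifiers countable, which
  makes the set where the limit superior is at most \<open>c\<close> measurable.\<close>

definition limsup_le :: "(nat \<Rightarrow> real) \<Rightarrow> real \<Rightarrow> bool" where
  "limsup_le u c \<longleftrightarrow> (\<forall>j. \<exists>N. \<forall>n\<ge>N. u n \<le> c + 1 / real (Suc j))"

lemma limsup_le_iff: "limsup_le u c \<longleftrightarrow> (\<forall>e>0. \<forall>\<^sub>F n in sequentially. u n \<le> c + e)"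
proof
  assume L: "limsup_le u c"
  show "\<forall>e>0. \<forall>\<^sub>F n in sequentially. u n \<le> c + e"
  proof (intro allI impI)
    fix e :: real
    assume "0 < e"
    then obtain j where j: "1 / real (Suc j) < e"
      using reals_Archimedean[of e] by (auto simp: inverse_eq_divide)
    obtain N where "\<forall>n\<ge>N. u n \<le> c + 1 / real (Suc j)" using L unfolding limsup_le_def by blast
    then show "\<forall>\<^sub>F n in sequentially. u n \<le> c + e"
      using j unfolding eventually_sequentially by (meson add_left_mono less_imp_le order_trans)
  qed
qed (auto simp: limsup_le_def eventually_sequentially)

lemma limsup_le_cong:
  assumes "(\<lambda>n. u n - v n) \<longlonglongrightarrow> 0" "limsup_le u c"
  shows "limsup_le v c"
  unfolding limsup_le_iff
proof (intro allI impI)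
  fix e :: real
  assume "0 < e"
  then have "\<forall>\<^sub>F n in sequentially. u n \<le> c + e / 2" using assms(2) limsup_le_iff half_gt_zero by blast
  moreover have "\<forall>\<^sub>F n in sequentially. dist (u n - v n) 0 < e / 2"
    using assms(1) \<open>0 < e\<close> unfolding tendsto_iff by (meson half_gt_zero)
  ultimately show "\<forall>\<^sub>F n in sequentially. v n \<le> c + e"
    by eventually_elim (unfold dist_real_def, linarith)
qed

lemma limsup_le_Suc: "limsup_le (\<lambda>n. u (Suc n)) c \<longleftrightarrow> limsup_le u c"
  unfolding limsup_le_iff
  by (simp add: eventually_sequentially_Suc[of "\<lambda>n. u n \<le> c + e" for e])

text \<open>After a shift of the index by one, the averages at \<open>x\<close> and at
  \<open>T x\<close> differ by \<open>O(1 / n)\<close>. The set on which \<open>limsup_le\<close>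
  holds is therefore invariant, and ergodicity applies to it.\<close>

lemma limsup_le_birkhoff_shift:
  assumes K: "\<And>x. \<bar>g x\<bar> \<le> K"
  shows "limsup_le (\<lambda>n. birkhoff_sum T g n (T x) / real n) c
    \<longleftrightarrow> limsup_le (\<lambda>n. birkhoff_sum T g n x / real n) c"
proof -
  let ?u = "\<lambda>n. birkhoff_sum T g (Suc n) x / real (Suc n)" and ?v = "\<lambda>n. birkhoff_sum T g n (T x) / real n"
  have "\<bar>?u n - ?v n\<bar> \<le> 2 * K / real n" if "0 < n" for n
  proof -
    let ?S = "birkhoff_sum T g (Suc n) x"
    have "?u n - ?v n = g x / real n - ?S / (real n * real (Suc n))"
    proof -
      have "S / (a + 1) - (S - y) / a = y / a - S / (a * (a + 1))" if "0 < a" for S y a :: real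
      proof -
        have "a \<noteq> 0" "a + 1 \<noteq> 0" using that by auto
        then show ?thesis by (simp add: divide_simps) (simp add: algebra_simps)
      qed
      from this[of "real n" ?S "g x"] show ?thesis
        using that by (simp add: birkhoff_sum_Suc add.commute)
    qed
    also have "\<bar>\<dots>\<bar> \<le> \<bar>g x\<bar> / real n + \<bar>?S\<bar> / (real n * real (Suc n))"
      using abs_triangle_ineq4[of "g x / real n" "?S / (real n * real (Suc n))"] that by simp
    also have "\<dots> \<le> K / real n + (real (Suc n) * K) / (real n * real (Suc n))"
      using K birkhoff_sum_bound[of g K T "Suc n" x] by (intro add_mono divide_right_mono) auto
    also have "\<dots> = K / real n + K / real n" using that by (simp del: of_nat_Suc)
    also have "\<dots> = 2 * K / real n" by simp
    finally show ?thesis .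
  qed
  then have "\<forall>\<^sub>F n in sequentially. norm (?u n - ?v n) \<le> 2 * K / real n"
    by (auto intro: eventually_mono[OF eventually_gt_at_top[of 0]])
  then have lim: "(\<lambda>n. ?u n - ?v n) \<longlonglongrightarrow> 0"
    by (rule Lim_null_comparison) (rule lim_const_over_n)
  moreover have "(\<lambda>n. ?v n - ?u n) \<longlonglongrightarrow> 0" using tendsto_minus[OF lim] by simp
  ultimately have "limsup_le ?v c \<longleftrightarrow> limsup_le ?u c"
    using limsup_le_cong[of ?u ?v c] limsup_le_cong[of ?v ?u c] by (metis (no_types))
  then show ?thesis using limsup_le_Suc[of "\<lambda>n. birkhoff_sum T g n x / real n"] by simp
qed

section \<open>Almost everywhere bounds and convergence in probability for ergodic maps\<close>

locale ergodic_system = measure_preserving_system +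
  assumes ergodic: "ergodic M T"
begin

text \<open>One half of Birkhoff's theorem. If the invariant set had measure 0, almost every point
  would have a positive Birkhoff sum of \<open>g - c\<close>. The sets \<open>E n\<close> would then
  exhaust the space, and \<open>maximal_ergodic\<close> would force the integral of \<open>g\<close>
  to be at least \<open>c\<close>.\<close>

lemma AE_limsup_le:
  assumes [measurable]: "g \<in> borel_measurable M" and K: "\<And>x. \<bar>g x\<bar> \<le> K"
    and c: "(\<integral>x. g x \<partial>M) < c"
  shows "AE x in M. limsup_le (\<lambda>n. birkhoff_sum T g n x / real n) c"
proof -
  define G where "G = {x \<in> space M. limsup_le (\<lambda>n. birkhoff_sum T g n x / real n) c}"
  have G [measurable]: "G \<in> events"
    unfolding G_def limsup_le_def by measurable
  have "T -` G \<inter> space M = G"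
    using measurable_space[OF measurable_T] limsup_le_birkhoff_shift[of g K T _ c, OF K] by (auto simp: G_def)
  then have "emeasure M G = 0 \<or> emeasure M G = 1"
    using ergodic G unfolding ergodic_def by blast
  moreover have "emeasure M G \<noteq> 0"
  proof
    assume 0: "emeasure M G = 0"
    let ?g = "\<lambda>x. g x - c"
    define E where "E n = {x \<in> space M. 0 < max_sum T ?g n x}" for n
    have E [measurable]: "E n \<in> events" for n unfolding E_def by measurable
    have "incseq E"
      unfolding E_def using max_sum_mono[of _ _ T ?g] by (auto simp: incseq_def intro: less_le_trans)
    then have lim: "(\<lambda>n. prob (E n)) \<longlonglongrightarrow> prob (\<Union>n. E n)"
      by (intro finite_Lim_measure_incseq) auto
    have "space M - G \<subseteq> (\<Union>n. E n)"
    proof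
      fix x
      assume x: "x \<in> space M - G"
      then obtain j where "\<forall>N. \<exists>n\<ge>N. c + 1 / real (Suc j) < birkhoff_sum T g n x / real n"
        unfolding G_def limsup_le_def by (auto simp: not_le)
      then obtain n where n: "1 \<le> n" "c + 1 / real (Suc j) < birkhoff_sum T g n x / real n" by blast
      have "c < birkhoff_sum T g n x / real n" using n(2) by (smt (verit) divide_pos_pos of_nat_0_less_iff zero_less_Suc)
      then have "0 < birkhoff_sum T ?g n x"
        using n(1) by (simp add: birkhoff_sum_diff_const field_simps)
      then show "x \<in> (\<Union>n. E n)"
        using x birkhoff_sum_le_max_sum[of T ?g n x] by (auto simp: E_def intro: less_le_trans)
    qed
    moreover have "prob (space M - G) = 1"
      using 0 prob_compl[OF G] by (simp add: measure_def[of M G])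
    ultimately have "1 \<le> prob (\<Union>n. E n)"
      using finite_measure_mono[of "space M - G" "\<Union>n. E n"] by auto
    then have lim1: "(\<lambda>n. prob (E n)) \<longlonglongrightarrow> 1" using lim by (metis antisym prob_le_1)
    have gc: "\<bar>?g x\<bar> \<le> K + \<bar>c\<bar>" for x using K[of x] by linarith
    \<comment> \<open>Since \<open>g - c\<close> is at most \<open>K + \<bar>c\<bar>\<close> in
      absolute value, extending its integral from \<open>E n\<close> to the whole space costs at
      most this bound times the measure of the complement.\<close>
    have "0 \<le> (\<integral>x. g x \<partial>M) - c + (K + \<bar>c\<bar>) * (1 - prob (E n))" for n
    proof -
      have int: "integrable M (\<lambda>x. ?g x * indicator (space M - E n) x)"
        using gc order_trans[OF abs_ge_zero gc]
        by (auto intro!: integrable_const_bound[where B = "K + \<bar>c\<bar>"] split: split_indicator)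
      have intg: "integrable M g" by (rule integrable_const_bound[where B = K]) (auto simp: K)
      have "0 \<le> (\<integral>x. ?g x * indicator (E n) x \<partial>M)"
        unfolding E_def by (rule maximal_ergodic[OF _ gc]) measurable
      also have "\<dots> = (\<integral>x. ?g x - ?g x * indicator (space M - E n) x \<partial>M)"
        by (intro Bochner_Integration.integral_cong) (auto split: split_indicator)
      also have "\<dots> = (\<integral>x. g x \<partial>M) - c - (\<integral>x. ?g x * indicator (space M - E n) x \<partial>M)"
        using int intg by (simp add: prob_space)
      finally have le: "0 \<le> (\<integral>x. g x \<partial>M) - c - (\<integral>x. ?g x * indicator (space M - E n) x \<partial>M)" .
      have "- (\<integral>x. ?g x * indicator (space M - E n) x \<partial>M)
          = (\<integral>x. - (?g x * indicator (space M - E n) x) \<partial>M)" by simp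
      also have "(\<integral>x. - (?g x * indicator (space M - E n) x) \<partial>M)
          \<le> (\<integral>x. (K + \<bar>c\<bar>) * indicator (space M - E n) x \<partial>M)"
        using int gc by (intro integral_mono) (auto simp: emeasure_eq_measure abs_le_iff split: split_indicator)
      also have "\<dots> = (K + \<bar>c\<bar>) * (1 - prob (E n))"
        by (simp add: prob_compl emeasure_eq_measure)
      finally show ?thesis using le by linarith
    qed
    moreover have "(\<lambda>n. (\<integral>x. g x \<partial>M) - c + (K + \<bar>c\<bar>) * (1 - prob (E n))) \<longlonglongrightarrow>
        (\<integral>x. g x \<partial>M) - c + (K + \<bar>c\<bar>) * (1 - 1)"
      by (intro tendsto_intros lim1)
    ultimately have "0 \<le> (\<integral>x. g x \<partial>M) - c + (K + \<bar>c\<bar>) * (1 - 1)"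
      by (intro LIMSEQ_le_const) auto
    then show False using c by simp
  qed
  ultimately have "prob G = 1" by (simp add: measure_def)
  then have "AE x in M. x \<in> G" using prob_eq_1[OF G] by simp
  then show ?thesis by (auto simp: G_def)
qed

text \<open>The one-sided bound is used for \<open>g\<close> and for \<open>- g\<close>, with margin
  \<open>e / 2\<close>; dominated convergence passes to measures. This guarantees that the search
  for a good block length succeeds.\<close>

lemma ergodic_convergence_in_probability:
  assumes [measurable]: "g \<in> borel_measurable M" and K: "\<And>x. \<bar>g x\<bar> \<le> K" and e: "0 < e"
  shows "(\<lambda>n. prob {x \<in> space M. e < \<bar>birkhoff_sum T g n x / real n - (\<integral>x. g x \<partial>M)\<bar>}) \<longlonglongrightarrow> 0"
proof -
  define m where "m = (\<integral>x. g x \<partial>M)"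
  define A where "A n = {x \<in> space M. e < \<bar>birkhoff_sum T g n x / real n - m\<bar>}" for n
  have A [measurable]: "A n \<in> events" for n unfolding A_def by measurable
  have "AE x in M. limsup_le (\<lambda>n. birkhoff_sum T g n x / real n) (m + e / 2)"
    using e by (intro AE_limsup_le[OF _ K]) (auto simp: m_def)
  moreover have "AE x in M. limsup_le (\<lambda>n. birkhoff_sum T (\<lambda>x. - g x) n x / real n) (- m + e / 2)"
    using e K by (intro AE_limsup_le[where K = K]) (auto simp: m_def)
  ultimately have "AE x in M. (\<lambda>n. indicator (A n) x :: real) \<longlonglongrightarrow> 0"
  proof eventually_elim
    case (elim x)
    have "\<forall>\<^sub>F n in sequentially. birkhoff_sum T g n x / real n \<le> m + e / 2 + e / 2"
      "\<forall>\<^sub>F n in sequentially. birkhoff_sum T (\<lambda>x. - g x) n x / real n \<le> - m + e / 2 + e / 2"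
      using elim e unfolding limsup_le_iff by (meson half_gt_zero)+
    then have "\<forall>\<^sub>F n in sequentially. indicator (A n) x = (0 :: real)"
      by eventually_elim (auto simp: A_def birkhoff_sum_uminus split: split_indicator)
    then show ?case by (rule tendsto_eventually)
  qed
  then have "(\<lambda>n. \<integral>x. (indicator (A n) x :: real) \<partial>M) \<longlonglongrightarrow> (\<integral>x. 0 \<partial>M)"
    by (rule integral_dominated_convergence[where w = "\<lambda>_. 1", rotated 3]) (auto split: split_indicator)
  then show ?thesis by (simp add: A_def m_def)
qed

end

section \<open>Binary strings and small exceptional sets\<close>

text \<open>Binary strings are represented by lists of natural numbers, whose codes are those of the
  corresponding Boolean lists.\<close>

abbreviation nat_string :: "bool list \<Rightarrow> nat list" where
  "nat_string \<equiv> map of_bool"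

definition bits :: "bool stream \<Rightarrow> nat \<Rightarrow> nat list" where
  "bits w n = nat_string (stake n w)"

definition is_binary :: "nat list \<Rightarrow> bool" where
  "is_binary x \<longleftrightarrow> (\<forall>a\<in>set x. a < 2)"

lemma encode_nat_string: "encode (nat_string x) = string_code x"
  by (simp add: encode_nat_list string_code_def)

lemma inj_nat_string: "inj nat_string"
  by (rule inj_mapI) (simp add: inj_def)

lemma binary_nat_string [simp]: "is_binary (nat_string x)"
  by (auto simp: is_binary_def)

lemma binary_iff_nat_string: "is_binary x \<longleftrightarrow> (\<exists>y. x = nat_string y)"
proof
  assume "is_binary x"
  then have "map (of_bool \<circ> (\<lambda>a. a = 1)) x = x"
    by (intro map_idI) (auto simp: is_binary_def dest!: bspec less_2_cases)
  then have "x = nat_string (map (\<lambda>a. a = 1) x)" by simp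
  then show "\<exists>y. x = nat_string y" by blast
qed auto

lemma prefix_nat_string [simp]: "prefix (nat_string x) (nat_string y) \<longleftrightarrow> prefix x y"
proof
  assume "prefix (nat_string x) (nat_string y)"
  then have "nat_string x = nat_string (take (length x) y)"
    by (metis append_eq_conv_conj length_map prefixE take_map)
  then show "prefix x y" using injD[OF inj_nat_string] by (metis take_is_prefix)
qed (rule map_mono_prefix)

lemma length_bits [simp]: "length (bits w n) = n"
  by (simp add: bits_def)

lemma binary_bits [simp]: "is_binary (bits w n)"
  by (simp add: bits_def)

lemma take_bits: "m \<le> n \<Longrightarrow> take m (bits w n) = bits w m"
  by (simp add: bits_def take_map take_stake min_def)

lemma prefix_bits: "m \<le> n \<Longrightarrow> prefix (bits w m) (bits w n)"
  by (metis take_bits take_is_prefix)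

lemma bits_eq_prefix:
  assumes "bits w (length x) = x" "prefix y x"
  shows "bits w (length y) = y"
  using take_bits[of "length y" "length x" w] assms prefix_length_le[OF assms(2)]
  by (metis append_eq_conv_conj prefixE)

lemma bits_nat_string: "bits w (length x) = nat_string x \<longleftrightarrow> FinSeq x \<le> InfSeq w"
  using inj_nat_string by (simp add: bits_def inj_eq)

lemma semidecidable_is_binary [semidecidable_intros]:
  assumes "computable f"
  shows "semidecidable (\<lambda>x. is_binary (f x))"
  unfolding is_binary_def by (intro semidecidable_intros computable_intros assms)

lemma card_binary: "card {x. is_binary x \<and> length x = n} = 2 ^ n"
proof -
  have "{x. is_binary x \<and> length x = n} = {x. set x \<subseteq> {..<2} \<and> length x = n}"
    by (auto simp: is_binary_def)
  then show ?thesis by (simp add: card_lists_length_eq)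
qed

lemma finite_binary: "finite {x. is_binary x \<and> length x = n}"
  by (rule card_ge_0_finite) (simp add: card_binary)

section \<open>Measures of sets determined by prefixes\<close>

interpretation B_half: prob_space B_half
  by (rule prob_space_B_half)

lemma bits_events: "{w. bits w n \<in> S} \<in> sets B_half"
proof -
  have "{w. bits w n \<in> S} = (\<Union>x\<in>{x. length x = n \<and> nat_string x \<in> S}. {w. stake (length x) w = x})"
    by (auto simp: bits_def)
  moreover have "countable {x. length x = n \<and> nat_string x \<in> S}" by simp
  ultimately show ?thesis using sets_cylinder by (auto intro!: sets.countable_UN'')
qed

lemma prob_bits: "B_half.prob {w. bits w n \<in> S} = card {x\<in>S. is_binary x \<and> length x = n} / 2 ^ n"
proof -
  let ?S = "{x\<in>S. is_binary x \<and> length x = n}"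
  have fin: "finite ?S" by (rule finite_subset[OF _ finite_binary[of n]]) auto
  have "{w. bits w n \<in> S} = (\<Union>x\<in>?S. {w. bits w n = x})" by auto
  also have "B_half.prob \<dots> = (\<Sum>x\<in>?S. B_half.prob {w. bits w n = x})"
    by (rule B_half.finite_measure_finite_Union[OF fin])
      (use bits_events[of n "{x}" for x] in \<open>auto simp: disjoint_family_on_def\<close>)
  also have "\<dots> = (\<Sum>x\<in>?S. 1 / 2 ^ n)"
  proof (rule sum.cong)
    fix x
    assume "x \<in> ?S"
    then obtain y where "x = nat_string y" "length y = n" by (auto simp: binary_iff_nat_string)
    then have "{w. bits w n = x} = {w. stake (length y) w = y}"
      using inj_nat_string by (auto simp: bits_def inj_eq)
    then show "B_half.prob {w. bits w n = x} = 1 / 2 ^ n"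
      using emeasure_cylinder[of y] \<open>length y = n\<close> by (simp add: measure_def power_one_over)
  qed simp
  finally show ?thesis by simp
qed

text \<open>The strings of length \<open>L\<close> without property \<open>Q\<close> are described by strings that are shorter
  by \<open>m\<close>; the list \<open>Z\<close> is the graph of the description function.\<close>

definition small_cover :: "nat \<Rightarrow> nat \<Rightarrow> (nat list \<Rightarrow> bool) \<Rightarrow> (nat list \<times> nat list) list \<Rightarrow> bool" where
  "small_cover m L Q Z \<longleftrightarrow> m \<le> L \<and>
     (\<forall>z\<in>set Z. is_binary (fst z) \<and> length (fst z) + m = L \<and> is_binary (snd z) \<and>
       (\<forall>z'\<in>set Z. fst z = fst z' \<longrightarrow> snd z = snd z')) \<and>
     (\<forall>x. is_binary x \<longrightarrow> length x = L \<longrightarrow> Q x \<or> (\<exists>z\<in>set Z. snd z = x))"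

text \<open>The list \<open>Z\<close> is the graph of a function on strings of length
  \<open>L - m\<close>, so at most \<open>2 ^ (L - m)\<close> strings of length \<open>L\<close>
  lack \<open>Q\<close>.\<close>

lemma small_cover_prob:
  assumes "small_cover m L Q Z"
  shows "B_half.prob {w. \<not> Q (bits w L)} \<le> 1 / 2 ^ m"
proof -
  let ?B = "{x \<in> {x. \<not> Q x}. is_binary x \<and> length x = L}" and ?U = "{u. is_binary u \<and> length u = L - m}"
  define h where "h u = snd (SOME z. z \<in> set Z \<and> fst z = u)" for u
  have h: "h (fst z) = snd z" if "z \<in> set Z" for z
  proof -
    define z' where "z' = (SOME z'. z' \<in> set Z \<and> fst z' = fst z)"
    have "z' \<in> set Z \<and> fst z' = fst z"
      unfolding z'_def by (rule someI[of _ z]) (simp add: that)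
    moreover have "\<forall>z\<in>set Z. \<forall>z'\<in>set Z. fst z = fst z' \<longrightarrow> snd z = snd z'"
      using assms unfolding small_cover_def by blast
    ultimately have "snd z' = snd z" using that by blast
    then show ?thesis unfolding h_def z'_def .
  qed
  have "?B \<subseteq> h ` ?U"
  proof
    fix x
    assume "x \<in> ?B"
    then obtain z where z: "z \<in> set Z" "snd z = x"
      using assms unfolding small_cover_def by blast
    then have "is_binary (fst z)" "length (fst z) + m = L"
      using assms unfolding small_cover_def by blast+
    then show "x \<in> h ` ?U" using h[OF z(1)] z(2) by (intro image_eqI[of _ _ "fst z"]) auto
  qed
  then have "card ?B \<le> card (h ` ?U)" by (intro card_mono finite_imageI finite_binary)
  also have "\<dots> \<le> card ?U" by (intro card_image_le finite_binary)
  finally have "card ?B \<le> 2 ^ (L - m)" by (simp add: card_binary)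
  then have "real (card ?B) / 2 ^ L \<le> 2 ^ (L - m) / 2 ^ L"
    by (intro divide_right_mono) (simp_all flip: of_nat_power add: of_nat_le_iff)
  also have "\<dots> = 1 / 2 ^ m"
    using assms by (simp add: small_cover_def power_diff)
  finally show ?thesis using prob_bits[of L "{x. \<not> Q x}"] by simp
qed

text \<open>As \<open>Q\<close> persists under extension, the sets of sequences with
  \<open>Q (bits w n)\<close> increase, and together they contain \<open>A\<close>; continuity of
  the measure provides \<open>L\<close>. The strings left over are few enough to inject into the
  strings of length \<open>L - m\<close>, and \<open>Z\<close> is the graph of the inverse.\<close>

lemma small_cover_exists:
  assumes mono: "\<And>x y. Q x \<Longrightarrow> prefix x y \<Longrightarrow> Q y"
    and A: "A \<in> sets B_half" "1 - 1 / 2 ^ m < B_half.prob A" "\<And>w. w \<in> A \<Longrightarrow> \<exists>n. Q (bits w n)"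
  shows "\<exists>L Z. small_cover m L Q Z"
proof -
  let ?A = "\<lambda>n. {w. bits w n \<in> {x. Q x}}"
  have "incseq ?A" using mono prefix_bits by (force simp: incseq_def)
  then have "(\<lambda>n. B_half.prob (?A n)) \<longlonglongrightarrow> B_half.prob (\<Union>n. ?A n)"
    using bits_events[of _ "{x. Q x}"] by (intro B_half.finite_Lim_measure_incseq) auto
  moreover have "B_half.prob A \<le> B_half.prob (\<Union>n. ?A n)"
    using A(3) bits_events[of _ "{x. Q x}"] by (intro B_half.finite_measure_mono) auto
  ultimately have "\<forall>\<^sub>F n in sequentially. 1 - 1 / 2 ^ m < B_half.prob (?A n)"
    using A(2) order_tendstoD(1) less_le_trans by blast
  then have "\<exists>L\<ge>m. 1 - 1 / 2 ^ m < B_half.prob (?A L)"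
    by (auto simp: eventually_sequentially) (metis nle_le)
  then obtain L where L: "m \<le> L" "1 - 1 / 2 ^ m < B_half.prob (?A L)" by blast
  let ?B = "{x \<in> {x. \<not> Q x}. is_binary x \<and> length x = L}" and ?U = "{u. is_binary u \<and> length u = L - m}"
  have finB: "finite ?B" by (rule finite_subset[OF _ finite_binary[of L]]) auto
  have "{w. bits w L \<in> {x. \<not> Q x}} = space B_half - ?A L" by auto
  then have "B_half.prob {w. bits w L \<in> {x. \<not> Q x}} < 1 / 2 ^ m"
    using L(2) B_half.prob_compl[of "?A L"] bits_events[of L "{x. Q x}"] by simp
  then have "real (card ?B) / 2 ^ L < 1 / 2 ^ m" using prob_bits[of L "{x. \<not> Q x}"] by simp
  then have "real (card ?B) < 2 ^ (L - m)"
    using L(1) by (simp add: field_simps power_diff)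
  then have "card ?B \<le> card ?U"
    by (simp add: card_binary flip: of_nat_power of_nat_less_iff of_nat_le_iff)
  then obtain h where h: "h ` ?B \<subseteq> ?U" "inj_on h ?B"
    using inj_on_iff_card_le[OF finB finite_binary[of "L - m"]] by blast
  obtain Z where Z: "set Z = (\<lambda>x. (h x, x)) ` ?B"
    using finite_list[OF finite_imageI[OF finB]] by (rule exE)
  have "small_cover m L Q Z"
    unfolding small_cover_def
  proof (intro conjI ballI impI allI L(1))
    fix z
    assume "z \<in> set Z"
    then obtain x where x: "z = (h x, x)" "x \<in> ?B" unfolding Z by (rule imageE)
    then have "h x \<in> ?U" using h(1) by (meson image_subset_iff)
    then show "is_binary (fst z)" "length (fst z) + m = L" "is_binary (snd z)"
      using x L(1) by auto
    fix z'
    assume "z' \<in> set Z" "fst z = fst z'"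
    from this(1) obtain x' where x': "z' = (h x', x')" "x' \<in> ?B" unfolding Z by (rule imageE)
    have "h x = h x'" using \<open>fst z = fst z'\<close> unfolding x(1) x'(1) fst_conv .
    then have "x = x'" by (rule inj_onD[OF h(2) _ x(2) x'(2)])
    then show "snd z = snd z'" unfolding x(1) x'(1) by simp
  next
    fix x
    assume "is_binary x" "length x = L"
    then show "Q x \<or> (\<exists>z\<in>set Z. snd z = x)" by (auto simp: Z)
  qed
  then show ?thesis by blast
qed

text \<open>Instead of quantifying over the strings of length \<open>L\<close>, one exhibits a list that contains
  the empty string and with a string shorter than \<open>L\<close> both of its extensions by one digit.\<close>

lemma all_binary_iff:
  "(\<forall>x. is_binary x \<longrightarrow> length x = L \<longrightarrow> R x) \<longleftrightarrow>
    (\<exists>S. [] \<in> set S \<and> (\<forall>x\<in>set S. (length x < L \<longrightarrow> 0 # x \<in> set S \<and> 1 # x \<in> set S) \<and>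
      (length x = L \<longrightarrow> R x)))" (is "?L \<longleftrightarrow> ?R")
proof
  assume ?L
  have "{x. is_binary x \<and> length x \<le> L} = (\<Union>n\<le>L. {x. is_binary x \<and> length x = n})" by auto
  then have "finite {x. is_binary x \<and> length x \<le> L}" using finite_binary by simp
  then obtain S where "set S = {x. is_binary x \<and> length x \<le> L}" using finite_list by blast
  then show ?R using \<open>?L\<close> by (intro exI[of _ S]) (auto simp: is_binary_def)
next
  assume ?R
  then obtain S where S: "[] \<in> set S" "\<forall>x\<in>set S. (length x < L \<longrightarrow> 0 # x \<in> set S \<and> 1 # x \<in> set S) \<and>
      (length x = L \<longrightarrow> R x)" by blast
  have "x \<in> set S" if "is_binary x" "length x \<le> L" for x
    using that
  proof (induction x)
    case (Cons a x)
    then have "x \<in> set S" "length x < L" "a = 0 \<or> a = 1" by (auto simp: is_binary_def)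
    then show ?case using S(2) by blast
  qed (use S in simp)
  then show ?L using S(2) by auto
qed


text \<open>\<open>Q\<close> is only semidecidable, which suffices because it occurs positively and,
  through \<open>all_binary_iff\<close>, under a quantifier over a finite list.\<close>

lemma semidecidable_small_cover:
  assumes Q: "semidecidable (\<lambda>p. Q (fst p) (snd p))"
    and m: "computable m" and L: "computable L" and Z: "computable Z"
  shows "semidecidable (\<lambda>a. small_cover (m a) (L a) (Q a) (Z a))"
  unfolding small_cover_def all_binary_iff Bex_def
  by (intro semidecidable_conj semidecidable_Ball semidecidable_imp semidecidable_Ex semidecidable_disj
      semidecidable_comp[OF Q, of "\<lambda>p. (fst (fst p), snd p)", unfolded fst_conv snd_conv])
    (intro semidecidable_intros computable_intros computable_comp[OF m] computable_comp[OF L]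
      computable_comp[OF Z])+

section \<open>Certified orbits and Birkhoff sums\<close>

text \<open>\<open>G\<close> certifies single steps of \<open>T\<close> on prefixes, and
  \<open>V x k v\<close> certifies that \<open>v / 2 ^ k\<close> approximates \<open>g\<close> on
  all extensions of \<open>x\<close>. The error 2 consists of one unit for a rational approximation
  and one for rounding it down. Nonnegativity of \<open>g\<close> permits natural numbers
  throughout.\<close>

locale effective_system = ergodic_system B_half T for T :: "bool stream \<Rightarrow> bool stream" +
  fixes g :: "bool stream \<Rightarrow> real" and B :: nat
    and G :: "(nat list \<times> nat list) set" and V :: "nat list \<Rightarrow> nat \<Rightarrow> nat \<Rightarrow> bool"
  assumes g_measurable [measurable]: "g \<in> borel_measurable B_half"
    and g_nonneg: "0 \<le> g w" and g_le: "g w \<le> real B"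
    and G_sound: "(x, y) \<in> G \<Longrightarrow> bits w (length x) = x \<Longrightarrow> bits (T w) (length y) = y"
    and G_complete: "\<exists>x y. (x, y) \<in> G \<and> bits w (length x) = x \<and> n \<le> length y"
    and G_semidecidable: "semidecidable (\<lambda>p. p \<in> G)"
    and V_sound: "V x k v \<Longrightarrow> bits w (length x) = x \<Longrightarrow> \<bar>2 ^ k * g w - real v\<bar> \<le> 2"
    and V_complete: "\<exists>x v. bits w (length x) = x \<and> V x k v"
    and V_mono: "V x k v \<Longrightarrow> prefix x y \<Longrightarrow> V y k v"
    and V_semidecidable: "semidecidable (\<lambda>p. V (fst p) (fst (snd p)) (snd (snd p)))"
begin

lemma abs_g_le: "\<bar>g w\<bar> \<le> real B"
  using g_nonneg g_le by simp

text \<open>\<open>orbit x j y\<close>: all sequences \<open>w\<close> extending \<open>x\<close> are certified to satisfy that \<open>(T ^^ j) w\<close>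
  extends \<open>y\<close>.\<close>

primrec orbit :: "nat list \<Rightarrow> nat \<Rightarrow> nat list \<Rightarrow> bool" where
  "orbit x 0 y \<longleftrightarrow> prefix y x"
| "orbit x (Suc j) y \<longleftrightarrow> (\<exists>z. orbit x j z \<and> (\<exists>u. prefix u z \<and> (u, y) \<in> G))"

lemma orbit_sound: "orbit x j y \<Longrightarrow> bits w (length x) = x \<Longrightarrow> bits ((T ^^ j) w) (length y) = y"
proof (induction j arbitrary: y)
  case 0
  then show ?case using bits_eq_prefix by simp
next
  case (Suc j)
  then obtain z u where z: "orbit x j z" "prefix u z" "(u, y) \<in> G" by auto
  then have "bits ((T ^^ j) w) (length u) = u" using Suc bits_eq_prefix by blast
  then show ?case using G_sound[OF z(3)] by simp
qed

lemma orbit_mono: "orbit x j y \<Longrightarrow> prefix x x' \<Longrightarrow> orbit x' j y"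
  by (induction j arbitrary: y) (auto intro: prefix_order.trans)

lemma orbit_complete: "\<exists>m y. orbit (bits w m) j y \<and> n \<le> length y"
proof (induction j arbitrary: n)
  case 0
  have "orbit (bits w n) 0 (bits w n)" by simp
  then show ?case by (metis length_bits order_refl)
next
  case (Suc j)
  obtain u y where u: "(u, y) \<in> G" "bits ((T ^^ j) w) (length u) = u" "n \<le> length y"
    using G_complete by blast
  obtain m z where z: "orbit (bits w m) j z" "length u \<le> length z" using Suc by blast
  have "bits ((T ^^ j) w) (length z) = z" using orbit_sound[OF z(1)] by simp
  then have "prefix u z" using u(2) z(2) prefix_bits by metis
  then show ?case using z u by auto
qed

lemma semidecidable_orbit: "semidecidable (\<lambda>p. orbit (fst p) (fst (snd p)) (snd (snd p)))"
  by (rule semidecidable_rec[OF _ _ orbit.simps])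
    (intro semidecidable_intros computable_intros
      semidecidable_comp[OF G_semidecidable, of "\<lambda>p. (snd p, snd (snd (snd (fst p))))"])+

definition value_at :: "nat list \<Rightarrow> nat \<Rightarrow> nat \<Rightarrow> nat \<Rightarrow> bool" where
  "value_at x k j v \<longleftrightarrow> (\<exists>y. orbit x j y \<and> V y k v)"

text \<open>Prefix and precision form one pair because \<open>semidecidable_rec\<close> carries a
  single parameter. The relation may have several values \<open>s\<close>, according to the
  approximations used, with an error of up to two units per term.\<close>

primrec partial_sum :: "nat list \<times> nat \<Rightarrow> nat \<Rightarrow> nat \<Rightarrow> bool" where
  "partial_sum a 0 s \<longleftrightarrow> s = 0"
| "partial_sum a (Suc n) s \<longleftrightarrow>
    (\<exists>r. partial_sum a n r \<and> (\<exists>v. value_at (fst a) (snd a) n v \<and> s = r + v))"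

lemma value_at_complete: "\<exists>m v. value_at (bits w m) k j v"
proof -
  obtain x v where x: "bits ((T ^^ j) w) (length x) = x" "V x k v" using V_complete by blast
  obtain m y where y: "orbit (bits w m) j y" "length x \<le> length y" using orbit_complete by blast
  have "bits ((T ^^ j) w) (length y) = y" using orbit_sound[OF y(1)] by simp
  then have "prefix x y" using x(1) y(2) prefix_bits by metis
  then show ?thesis using V_mono[OF x(2)] y(1) unfolding value_at_def by blast
qed

lemma value_at_mono: "value_at x k j v \<Longrightarrow> prefix x x' \<Longrightarrow> value_at x' k j v"
  using orbit_mono unfolding value_at_def by blast

lemma partial_sum_mono: "partial_sum (x, k) n s \<Longrightarrow> prefix x x' \<Longrightarrow> partial_sum (x', k) n s"
  by (induction n arbitrary: s) (auto intro: value_at_mono)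

lemma partial_sum_complete: "\<exists>m s. partial_sum (bits w m, k) n s"
proof (induction n)
  case (Suc n)
  then obtain m s where s: "partial_sum (bits w m, k) n s" by blast
  obtain m' v where v: "value_at (bits w m') k n v" using value_at_complete by blast
  have "partial_sum (bits w (max m m'), k) n s" "value_at (bits w (max m m')) k n v"
    using partial_sum_mono[OF s] value_at_mono[OF v] prefix_bits by simp_all
  then have "partial_sum (bits w (max m m'), k) (Suc n) (s + v)" by auto
  then show ?case by blast
qed auto

lemma partial_sum_sound:
  assumes "bits w (length x) = x" "partial_sum (x, k) n s"
  shows "\<bar>2 ^ k * birkhoff_sum T g n w - real s\<bar> \<le> 2 * real n"
  using assms(2)
proof (induction n arbitrary: s)
  case (Suc n)
  then obtain r y v where r: "partial_sum (x, k) n r" "orbit x n y" "V y k v" "s = r + v"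
    by (auto simp: value_at_def)
  have "\<bar>2 ^ k * g ((T ^^ n) w) - real v\<bar> \<le> 2"
    using V_sound[OF r(3)] orbit_sound[OF r(2) assms(1)] by blast
  then show ?case
    using Suc.IH[OF r(1)] r(4) unfolding birkhoff_sum_def by (simp add: distrib_left)
qed simp

lemma semidecidable_partial_sum: "semidecidable (\<lambda>p. partial_sum (fst p) (fst (snd p)) (snd (snd p)))"
proof (rule semidecidable_rec[OF _ _ partial_sum.simps])
  have "semidecidable (\<lambda>p. value_at (fst p) (fst (snd p)) (fst (snd (snd p))) (snd (snd (snd p))))"
    unfolding value_at_def
    by (intro semidecidable_intros computable_intros
        semidecidable_comp[OF semidecidable_orbit, of
          "\<lambda>p. (fst (fst p), fst (snd (snd (fst p))), snd p)", unfolded fst_conv snd_conv]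
        semidecidable_comp[OF V_semidecidable, of
          "\<lambda>p. (snd p, fst (snd (fst p)), snd (snd (snd (fst p))))", unfolded fst_conv snd_conv])
  note * = semidecidable_comp[OF this, of
    "\<lambda>p. (fst (fst (fst p)), snd (fst (fst p)), fst (snd (fst p)), snd p)", unfolded fst_conv snd_conv]
  show "semidecidable (\<lambda>p. \<exists>v. value_at (fst (fst p)) (snd (fst p)) (fst (snd p)) v \<and>
      snd (snd (snd p)) = fst (snd (snd p)) + v)"
    by (intro semidecidable_intros computable_intros *)
qed (intro semidecidable_intros computable_intros)

text \<open>A certificate that \<open>2 ^ k\<close> times the \<open>n\<close>-th Birkhoff average is within \<open>d + 2\<close> of \<open>t\<close>, for all
  \<open>n\<close> in an interval.\<close>

definition close_averages :: "nat \<times> nat \<times> nat \<times> nat \<times> nat \<Rightarrow> nat list \<Rightarrow> bool" where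
  "close_averages = (\<lambda>(k, t, d, n1, n2) x. \<forall>n<n2. n1 \<le> n \<longrightarrow>
    (\<exists>s. partial_sum (x, k) n s \<and> s \<le> n * (t + d) \<and> n * t \<le> s + n * d))"

lemma close_averages_mono: "close_averages a x \<Longrightarrow> prefix x y \<Longrightarrow> close_averages a y"
  using partial_sum_mono unfolding close_averages_def by (force split: prod.splits)

lemma close_averages_sound:
  assumes "close_averages (k, t, d, n1, n2) (bits w L)" "n1 \<le> n" "n < n2"
  shows "\<bar>2 ^ k * birkhoff_sum T g n w - real n * real t\<bar> \<le> real n * (real d + 2)"
proof -
  obtain s where s: "partial_sum (bits w L, k) n s" "s \<le> n * (t + d)" "n * t \<le> s + n * d"
    using assms unfolding close_averages_def by auto
  have "real s \<le> real n * real t + real n * real d" "real n * real t \<le> real s + real n * real d"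
    using s(2,3) unfolding distrib_left by (simp_all flip: of_nat_mult of_nat_add)
  then show ?thesis
    using partial_sum_sound[OF _ s(1), of w] by (simp add: distrib_left)
qed

text \<open>The sums found err by at most \<open>2 * n\<close>, and the slack between
  \<open>d - 2\<close> and \<open>d\<close> absorbs this. Finitely many \<open>n\<close> can share
  one prefix; its length \<open>?m\<close> is the sum of the individual lengths.\<close>

lemma close_averages_complete:
  assumes "\<And>n. n1 \<le> n \<Longrightarrow> n < n2 \<Longrightarrow>
    \<bar>2 ^ k * birkhoff_sum T g n w - real n * real t\<bar> \<le> real n * (real d - 2)"
  shows "\<exists>m. close_averages (k, t, d, n1, n2) (bits w m)"
proof -
  obtain M S where MS: "\<And>n. partial_sum (bits w (M n), k) n (S n)"
    using partial_sum_complete by metis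
  let ?m = "\<Sum>n<n2. M n"
  have "partial_sum (bits w ?m, k) n (S n)" if "n < n2" for n
    using partial_sum_mono[OF MS[of n]] prefix_bits member_le_sum[of n "{..<n2}" M] that by simp
  moreover have "S n \<le> n * (t + d) \<and> n * t \<le> S n + n * d" if "n1 \<le> n" "n < n2" for n
  proof -
    have "\<bar>2 ^ k * birkhoff_sum T g n w - real (S n)\<bar> \<le> 2 * real n"
      by (rule partial_sum_sound[OF _ MS[of n]]) simp
    then have "real (S n) \<le> real n * real t + real n * real d" "real n * real t \<le> real (S n) + real n * real d"
      using assms[OF that] by (simp_all add: right_diff_distrib)
    then show ?thesis unfolding distrib_left by (simp_all flip: of_nat_mult of_nat_add)
  qed
  ultimately have "close_averages (k, t, d, n1, n2) (bits w ?m)"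
    unfolding close_averages_def by blast
  then show ?thesis by blast
qed

lemma semidecidable_close_averages: "semidecidable (\<lambda>p. close_averages (fst p) (snd p))"
  unfolding close_averages_def case_prod_beta
  by (intro semidecidable_intros computable_intros
      semidecidable_comp[OF semidecidable_partial_sum, of
        "\<lambda>p. ((snd (fst (fst p)), fst (fst (fst (fst p)))), snd (fst p), snd p)", unfolded fst_conv snd_conv])

end

section \<open>Comparison of sums of blocks with plain Birkhoff sums\<close>

lemma birkhoff_sum_add:
  "birkhoff_sum T g (m + n) x = birkhoff_sum T g m x + birkhoff_sum T g n ((T ^^ m) x)"
  by (induction m arbitrary: x) (simp_all add: birkhoff_sum_Suc funpow_swap1)

text \<open>Summing blocks counts every term \<open>M\<close> times except near both ends. In the
  induction, shifting the sum by \<open>M\<close> steps exchanges two boundary sums that lie between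
  0 and \<open>M * B\<close>.\<close>

lemma birkhoff_sum_birkhoff_sum:
  fixes g :: "'a \<Rightarrow> real"
  assumes g: "\<And>x. 0 \<le> g x" "\<And>x. g x \<le> B"
  shows "\<bar>birkhoff_sum T (birkhoff_sum T g M) n x - real M * birkhoff_sum T g n x\<bar> \<le> real M * real M * B"
proof (induction M)
  case 0
  then show ?case by (simp add: birkhoff_sum_def)
next
  case (Suc M)
  let ?S = "birkhoff_sum T g"
  have B: "0 \<le> B" using g order_trans by blast
  have S: "0 \<le> ?S M y" "?S M y \<le> real M * B" for y
    using g sum_bounded_above[of "{..<M}" "\<lambda>k. g ((T ^^ k) y)" B]
    by (auto simp: birkhoff_sum_def intro: sum_nonneg)
  have "(\<Sum>k<n. g ((T ^^ M) ((T ^^ k) x))) = ?S n ((T ^^ M) x)"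
    unfolding birkhoff_sum_def by (simp flip: funpow_add[THEN fun_cong, unfolded comp_def] add: add.commute)
  also have "\<dots> = ?S n x + ?S M ((T ^^ n) x) - ?S M x"
    using birkhoff_sum_add[of T g M n x] birkhoff_sum_add[of T g n M x] by (simp add: add.commute)
  finally have "birkhoff_sum T (?S (Suc M)) n x
      = birkhoff_sum T (?S M) n x + (?S n x + ?S M ((T ^^ n) x) - ?S M x)"
    unfolding birkhoff_sum_def by (simp add: sum.distrib)
  then have "\<bar>birkhoff_sum T (?S (Suc M)) n x - real (Suc M) * ?S n x\<bar> \<le> real M * real M * B + real M * B"
    using Suc S[of x] S[of "(T ^^ n) x"] unfolding of_nat_Suc distrib_right by linarith
  also have "\<dots> \<le> real (Suc M) * real (Suc M) * B" using B by (simp add: algebra_simps)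
  finally show ?case .
qed

section \<open>Existence and meaning of the certificates, and the computable rate\<close>

context effective_system
begin

definition mean :: real where
  "mean = (\<integral>w. g w \<partial>B_half)"

lemma integrable_g: "integrable B_half g"
  by (rule integrable_const_bound[where B = B]) (auto simp: abs_g_le)

lemma mean_nonneg: "0 \<le> mean" and mean_le: "mean \<le> real B"
proof -
  show "0 \<le> mean" unfolding mean_def by (rule Bochner_Integration.integral_nonneg) (simp add: g_nonneg)
  have "mean \<le> (\<integral>w. real B \<partial>B_half)"
    unfolding mean_def by (rule integral_mono) (auto simp: integrable_g g_le)
  then show "mean \<le> real B" using prob_space by simp
qed

text \<open>Convergence in probability gives an \<open>M\<close> with deviation above
  \<open>2 ^ -k\<close> only on a set of measure less than \<open>2 ^ -k\<close>, and
  \<open>t\<close> is the integer part of \<open>2 ^ k * mean\<close>. Each contributes one unit of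
  error and \<open>close_averages_complete\<close> needs two more, whence the 4. The interval from
  \<open>M\<close> to \<open>Suc M\<close> singles out the index \<open>M\<close>.\<close>

lemma average_certificate_exists:
  "\<exists>M t L Z. 1 \<le> M \<and> t \<le> B * 2 ^ k \<and> small_cover k L (close_averages (k, t, 4, M, Suc M)) Z"
proof -
  let ?A = "\<lambda>n. {w \<in> space B_half. 1 / 2 ^ k < \<bar>birkhoff_sum T g n w / real n - mean\<bar>}"
  have "(\<lambda>n. prob (?A n)) \<longlonglongrightarrow> 0"
    unfolding mean_def by (rule ergodic_convergence_in_probability[OF _ abs_g_le]) auto
  then have "\<forall>\<^sub>F n in sequentially. prob (?A n) < 1 / 2 ^ k \<and> 1 \<le> n"
    by (intro eventually_conj order_tendstoD(2) eventually_ge_at_top) auto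
  then obtain M where M: "prob (?A M) < 1 / 2 ^ k" "1 \<le> M"
    using eventually_happens'[OF sequentially_bot] by blast
  define t where "t = nat \<lfloor>2 ^ k * mean\<rfloor>"
  have t: "real t \<le> 2 ^ k * mean" "2 ^ k * mean \<le> real t + 1"
    using mean_nonneg by (auto simp: t_def of_nat_nat)
  have "real t \<le> real (B * 2 ^ k)"
  proof -
    have "2 ^ k * mean \<le> 2 ^ k * real B" by (intro mult_left_mono mean_le) simp
    moreover have "real (B * 2 ^ k) = 2 ^ k * real B" by simp
    ultimately show ?thesis using t(1) by linarith
  qed
  then have tB: "t \<le> B * 2 ^ k" by (simp only: of_nat_le_iff)
  have ev: "?A M \<in> events" by measurable
  have "\<exists>L Z. small_cover k L (close_averages (k, t, 4, M, Suc M)) Z"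
  proof (rule small_cover_exists[of _ "space B_half - ?A M"])
    show "1 - 1 / 2 ^ k < prob (space B_half - ?A M)" using M(1) prob_compl[OF ev] by simp
    show "\<exists>m. close_averages (k, t, 4, M, Suc M) (bits w m)" if "w \<in> space B_half - ?A M" for w
    proof (rule close_averages_complete)
      fix n
      assume "M \<le> n" "n < Suc M"
      then have n: "n = M" by simp
      define a where "a = birkhoff_sum T g M w / real M"
      have S: "birkhoff_sum T g M w = real M * a" using M(2) by (simp add: a_def)
      have "\<bar>a - mean\<bar> \<le> 1 / 2 ^ k" using that by (simp add: a_def)
      then have "2 ^ k * \<bar>a - mean\<bar> \<le> 1" by (simp add: field_simps)
      then have "\<bar>2 ^ k * (a - mean)\<bar> \<le> 1" by (simp only: abs_mult power_abs abs_numeral)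
      then have "\<bar>2 ^ k * a - real t\<bar> \<le> 2" using t by (simp add: right_diff_distrib abs_le_iff)
      then have "real M * \<bar>2 ^ k * a - real t\<bar> \<le> real M * 2" by (intro mult_left_mono) auto
      also have "real M * \<bar>2 ^ k * a - real t\<bar> = \<bar>2 ^ k * birkhoff_sum T g n w - real n * real t\<bar>"
        unfolding n S by (subst abs_of_nat[symmetric], subst abs_mult[symmetric]) (simp add: algebra_simps)
      finally show "\<bar>2 ^ k * birkhoff_sum T g n w - real n * real t\<bar> \<le> real n * (real 4 - 2)"
        by (simp add: n)
    qed
    show "space B_half - ?A M \<in> events" using ev by (rule sets.compl_sets)
  qed (rule close_averages_mono)
  then show ?thesis using M(2) tB by blast
qed

text \<open>Outside the exceptional set, tolerance 4 and approximation error 2 give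
  \<open>6 / 2 ^ k\<close>. On it, the deviation is at most \<open>B\<close>, as the bound on
  \<open>t\<close> places both numbers between 0 and \<open>B\<close>, and its measure is at most
  \<open>2 ^ -k\<close>. The second claim follows because the averages have integral
  \<open>mean\<close>.\<close>

lemma average_certificate_sound:
  assumes "1 \<le> M" "t \<le> B * 2 ^ k" "small_cover k L (close_averages (k, t, 4, M, Suc M)) Z"
  shows "(\<integral>w. \<bar>birkhoff_sum T g M w / real M - real t / 2 ^ k\<bar> \<partial>B_half) \<le> (6 + real B) / 2 ^ k"
    and "\<bar>real t / 2 ^ k - mean\<bar> \<le> (6 + real B) / 2 ^ k"
proof -
  let ?h = "\<lambda>w. birkhoff_sum T g M w / real M - real t / 2 ^ k"
  let ?E = "{w. bits w L \<in> {x. \<not> close_averages (k, t, 4, M, Suc M) x}}"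
  have ev [measurable]: "?E \<in> events" by (rule bits_events)
  have "real t \<le> real (B * 2 ^ k)" using assms(2) by (simp only: of_nat_le_iff)
  then have q: "0 \<le> real t / 2 ^ k" "real t / 2 ^ k \<le> real B" by (simp_all add: divide_le_eq)
  have a: "0 \<le> birkhoff_sum T g M w / real M" "birkhoff_sum T g M w / real M \<le> real B" for w
  proof -
    show "0 \<le> birkhoff_sum T g M w / real M"
      by (auto simp: birkhoff_sum_def intro!: divide_nonneg_nonneg sum_nonneg g_nonneg)
    show "birkhoff_sum T g M w / real M \<le> real B"
      using birkhoff_sum_bound[of g B T M w] abs_g_le assms(1) by (simp add: divide_le_eq mult.commute)
  qed
  have hB: "\<bar>?h w\<bar> \<le> real B" for w using a[of w] q by linarith
  have hE: "\<bar>?h w\<bar> \<le> 6 / 2 ^ k" if "w \<notin> ?E" for w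
  proof -
    have "\<bar>2 ^ k * birkhoff_sum T g M w - real M * real t\<bar> \<le> real M * (real 4 + 2)"
      using that by (intro close_averages_sound[of k t 4 M "Suc M" w L]) auto
    also have "2 ^ k * birkhoff_sum T g M w - real M * real t = (real M * 2 ^ k) * ?h w"
      using assms(1) by (simp add: field_simps)
    finally have "(real M * 2 ^ k) * \<bar>?h w\<bar> \<le> real M * 6" by (simp add: abs_mult)
    then show ?thesis using assms(1) by (simp add: field_simps)
  qed
  have inth: "integrable B_half ?h"
    by (rule integrable_const_bound[where B = B]) (auto simp: hB)
  have intE: "integrable B_half (\<lambda>w. real B * indicator ?E w)"
    by (intro integrable_mult_right integrable_real_indicator[OF ev]) (simp add: emeasure_eq_measure)
  have "(\<integral>w. \<bar>?h w\<bar> \<partial>B_half) \<le> (\<integral>w. 6 / 2 ^ k + real B * indicator ?E w \<partial>B_half)"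
  proof (rule integral_mono)
    show "\<bar>?h w\<bar> \<le> 6 / 2 ^ k + real B * indicator ?E w" for w
    proof (cases "w \<in> ?E")
      case True
      have "\<bar>?h w\<bar> \<le> real B" by (rule hB)
      then show ?thesis using True by (simp add: add_increasing)
    next
      case False
      then show ?thesis using hE[OF False] by simp
    qed
    show "integrable B_half (\<lambda>w. 6 / 2 ^ k + real B * indicator ?E w)"
      by (intro Bochner_Integration.integrable_add intE) auto
  qed (use inth in auto)
  also have "\<dots> = 6 / 2 ^ k + real B * prob ?E"
    using prob_space by (subst Bochner_Integration.integral_add[OF _ intE]) auto
  also have "\<dots> \<le> 6 / 2 ^ k + real B * (1 / 2 ^ k)"
    using small_cover_prob[OF assms(3)] by (intro add_left_mono mult_left_mono) auto
  also have "\<dots> = (6 + real B) / 2 ^ k" by (simp add: add_divide_distrib)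
  finally show *: "(\<integral>w. \<bar>?h w\<bar> \<partial>B_half) \<le> (6 + real B) / 2 ^ k" .
  have "(\<integral>w. ?h w \<partial>B_half) = mean - real t / 2 ^ k"
  proof -
    have "integrable B_half (birkhoff_sum T g M)"
      by (rule integrable_const_bound[where B = "real M * real B"]) (auto simp: birkhoff_sum_bound abs_g_le)
    then show ?thesis
      using integral_birkhoff_sum[OF g_measurable abs_g_le, of M] assms(1) prob_space
      by (simp add: mean_def)
  qed
  then show "\<bar>real t / 2 ^ k - mean\<bar> \<le> (6 + real B) / 2 ^ k"
    using * integral_abs_bound[of B_half ?h] by (simp add: abs_minus_commute)
qed

text \<open>The maximal inequality for the block average minus \<open>t / 2 ^ k\<close>, at
  threshold \<open>2 ^ -i\<close>, leaves an exceptional set of measure below \<open>2 ^ -m\<close>.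
  Returning from block averages to \<open>g\<close> costs \<open>B * M\<close>, which is at most
  \<open>n / 2 ^ i\<close> from \<open>n1\<close> on. The two errors add up to
  \<open>2 * n / 2 ^ i\<close>, for which \<open>d\<close> leaves room.\<close>

lemma block_certificate_exists:
  assumes int: "(\<integral>w. \<bar>birkhoff_sum T g M w / real M - real t / 2 ^ k\<bar> \<partial>B_half) < 1 / 2 ^ (m + i)"
    and M: "1 \<le> M" and n1: "B * M * 2 ^ i \<le> n1" and d: "2 * 2 ^ k \<le> (real d - 2) * 2 ^ i"
  shows "\<exists>L Z. small_cover m L (close_averages (k, t, d, n1, n2)) Z"
proof -
  let ?q = "real t / 2 ^ k"
  let ?h = "\<lambda>w. birkhoff_sum T g M w / real M - ?q"
  let ?E = "{w \<in> space B_half. \<exists>n\<in>{1..n2}. real n * (1 / 2 ^ i) < \<bar>birkhoff_sum T ?h n w\<bar>}"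
  have [measurable]: "?h \<in> borel_measurable B_half" by measurable
  have ev: "?E \<in> events" by measurable
  have hK: "\<bar>?h w\<bar> \<le> real B + ?q" for w
  proof -
    have "\<bar>birkhoff_sum T g M w / real M\<bar> \<le> real B"
      using birkhoff_sum_bound[of g B T M w] abs_g_le M by (simp add: divide_le_eq mult.commute)
    moreover have "0 \<le> ?q" by simp
    ultimately show ?thesis by linarith
  qed
  have "1 / 2 ^ i * prob ?E \<le> (\<integral>w. \<bar>?h w\<bar> \<partial>B_half)"
    by (rule maximal_inequality[OF _ hK]) auto
  also have "\<dots> < 1 / 2 ^ i * (1 / 2 ^ m)" using int by (simp add: power_add mult.commute)
  finally have E: "prob ?E < 1 / 2 ^ m" by (rule mult_left_less_imp_less) simp
  show ?thesis
  proof (rule small_cover_exists[of _ "space B_half - ?E"])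
    show "1 - 1 / 2 ^ m < prob (space B_half - ?E)" using E prob_compl[OF ev] by simp
    show "\<exists>m. close_averages (k, t, d, n1, n2) (bits w m)" if w: "w \<in> space B_half - ?E" for w
    proof (rule close_averages_complete)
      fix n
      assume n: "n1 \<le> n" "n < n2"
      let ?S = "birkhoff_sum T g n w"
      have "\<bar>birkhoff_sum T ?h n w\<bar> \<le> real n / 2 ^ i"
        using w n by (cases "n = 0") (auto simp: not_less)
      moreover have "birkhoff_sum T ?h n w = birkhoff_sum T (birkhoff_sum T g M) n w / real M - real n * ?q"
        by (simp add: birkhoff_sum_diff_const) (simp add: birkhoff_sum_def sum_divide_distrib)
      moreover have "\<bar>birkhoff_sum T (birkhoff_sum T g M) n w / real M - ?S\<bar> \<le> real n / 2 ^ i"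
      proof -
        have "\<bar>birkhoff_sum T (birkhoff_sum T g M) n w / real M - ?S\<bar>
            = \<bar>birkhoff_sum T (birkhoff_sum T g M) n w - real M * ?S\<bar> / real M"
        proof -
          have "x / real M - y = (x - real M * y) / real M" for x y
            using M by (simp add: diff_divide_distrib)
          then show ?thesis by (simp only: abs_divide abs_of_nat)
        qed
        also have "\<dots> \<le> real M * real M * real B / real M"
          by (intro divide_right_mono birkhoff_sum_birkhoff_sum g_nonneg g_le) simp
        also have "\<dots> = real B * real M" using M by simp
        also have "\<dots> \<le> real n / 2 ^ i"
        proof -
          have "real (B * M * 2 ^ i) \<le> real n" using n1 n(1) by (simp only: of_nat_le_iff)
          then show ?thesis by (simp add: field_simps)
        qed
        finally show ?thesis .
      qed
      ultimately have "\<bar>?S - real n * ?q\<bar> \<le> 2 * (real n / 2 ^ i)" by linarith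
      then have "2 ^ k * \<bar>?S - real n * ?q\<bar> \<le> 2 ^ k * (2 * (real n / 2 ^ i))" by (intro mult_left_mono) auto
      moreover have "2 ^ k * \<bar>?S - real n * ?q\<bar> = \<bar>2 ^ k * ?S - real n * real t\<bar>"
      proof -
        have "2 ^ k * \<bar>?S - real n * ?q\<bar> = \<bar>2 ^ k * (?S - real n * ?q)\<bar>" by (simp add: abs_mult)
        then show ?thesis by (simp add: right_diff_distrib)
      qed
      moreover have "2 ^ k * (2 * (real n / 2 ^ i)) = real n * (2 * 2 ^ k / 2 ^ i)" by simp
      moreover have "real n * (2 * 2 ^ k / 2 ^ i) \<le> real n * (real d - 2)"
        using d by (intro mult_left_mono) (simp_all add: divide_le_eq)
      ultimately show "\<bar>2 ^ k * ?S - real n * real t\<bar> \<le> real n * (real d - 2)" by linarith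
    qed
    show "space B_half - ?E \<in> events" using ev by (rule sets.compl_sets)
  qed (rule close_averages_mono)
qed

theorem effective_rate:
  "\<exists>L Z Q. computable L \<and> computable Z \<and> (\<forall>i. small_cover (3 * i) (L i) (Q i) (Z i)) \<and>
    (\<forall>w. (\<forall>\<^sub>F i in sequentially. Q i (bits w (L i)))
      \<longrightarrow> (\<lambda>n. birkhoff_sum T g n w / real n) \<longlonglongrightarrow> mean)"
proof -
  \<comment> \<open>The extra precision \<open>\<kappa>\<close> absorbs the factor
    \<open>6 + B\<close> of \<open>average_certificate_sound\<close>.\<close>
  define \<kappa> where "\<kappa> = 6 + B"
  have \<kappa>: "6 + real B < 2 ^ \<kappa>"
  proof -
    have "real \<kappa> < 2 ^ \<kappa>" by (rule of_nat_less_two_power)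
    then show ?thesis by (simp add: \<kappa>_def)
  qed
  let ?k = "\<lambda>i. 4 * i + \<kappa>"
  \<comment> \<open>Here \<open>r\<close> packs the block length, the centre \<open>t\<close>, the
    length of the cover and the cover itself.\<close>
  let ?P = "\<lambda>i r. 1 \<le> fst r \<and> fst (snd r) \<le> B * 2 ^ ?k i \<and> small_cover (?k i) (fst (snd (snd r)))
    (close_averages (?k i, fst (snd r), 4, fst r, Suc (fst r))) (snd (snd (snd r)))"
  have "semidecidable (\<lambda>p. ?P (fst p) (snd p))"
    by (intro semidecidable_intros semidecidable_small_cover computable_intros
        semidecidable_comp[OF semidecidable_close_averages, of "\<lambda>p. ((?k (fst (fst p)), fst (snd (snd (fst p))), 4,
          fst (snd (fst p)), Suc (fst (snd (fst p)))), snd p)", unfolded fst_conv snd_conv])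
  moreover have "\<exists>r. ?P i r" for i
    using average_certificate_exists[of "?k i"] by (metis fst_conv snd_conv)
  ultimately obtain h where h: "computable h" "\<And>i. ?P i (h i)"
    using semidecidable_selection[of ?P] by blast
  define M where "M i = fst (h i)" for i
  define t where "t i = fst (snd (h i))" for i
  \<comment> \<open>The first summand is what \<open>block_certificate_exists\<close> asks of
    \<open>n1\<close>; the second makes \<open>N\<close> unbounded also for
    \<open>B = 0\<close>.\<close>
  define N where "N i = B * M i * 2 ^ i + i" for i
  have Mt: "computable M" "computable t"
    unfolding M_def[abs_def] t_def[abs_def] by (intro computable_intros h)+
  have N: "computable N"
    unfolding N_def[abs_def] by (intro computable_intros Mt)
  have M1: "1 \<le> M i" for i using h(2) by (simp add: M_def)
  have cert: "(\<integral>w. \<bar>birkhoff_sum T g (M i) w / real (M i) - real (t i) / 2 ^ ?k i\<bar> \<partial>B_half) < 1 / 2 ^ (4 * i)"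
    "\<bar>real (t i) / 2 ^ ?k i - mean\<bar> < 1 / 2 ^ (4 * i)" for i
  proof -
    have "(6 + real B) / 2 ^ ?k i < 1 / 2 ^ (4 * i)"
      using \<kappa> by (simp add: power_add divide_less_eq)
    then show "(\<integral>w. \<bar>birkhoff_sum T g (M i) w / real (M i) - real (t i) / 2 ^ ?k i\<bar> \<partial>B_half) < 1 / 2 ^ (4 * i)"
      "\<bar>real (t i) / 2 ^ ?k i - mean\<bar> < 1 / 2 ^ (4 * i)"
      using average_certificate_sound[of "M i" "t i" "?k i"] h(2)[of i] unfolding M_def t_def
      by (meson le_less_trans)+
  qed
  \<comment> \<open>In units of \<open>2 ^ -(4 * i + \<kappa>)\<close> the deviation
    \<open>2 / 2 ^ i\<close> is \<open>2 * 2 ^ (3 * i + \<kappa>)\<close>; twice that makes room for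
    the approximation error 2.\<close>
  define Q where "Q i = close_averages (?k i, t i, 2 ^ (3 * i + \<kappa> + 2), N i, N (Suc i))" for i
  let ?R = "\<lambda>i r. small_cover (3 * i) (fst r) (Q i) (snd r)"
  have "semidecidable (\<lambda>p. ?R (fst p) (snd p))"
    unfolding Q_def
    by (intro semidecidable_intros semidecidable_small_cover computable_intros
        computable_comp[OF Mt(2)] computable_comp[OF N]
        semidecidable_comp[OF semidecidable_close_averages, of "\<lambda>p. ((?k (fst (fst p)), t (fst (fst p)),
          2 ^ (3 * fst (fst p) + \<kappa> + 2), N (fst (fst p)), N (Suc (fst (fst p)))), snd p)", unfolded fst_conv snd_conv])
  moreover have "\<exists>r. ?R i r" for i
  proof -
    have "(2 :: real) \<le> 2 * 2 ^ (3 * i + \<kappa>)" by simp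
    then have "2 * 2 ^ (3 * i + \<kappa>) \<le> real (2 ^ (3 * i + \<kappa> + 2)) - 2"
      unfolding of_nat_power by simp
    then have "2 * 2 ^ (3 * i + \<kappa>) * 2 ^ i \<le> (real (2 ^ (3 * i + \<kappa> + 2)) - 2) * 2 ^ i"
      by (intro mult_right_mono) auto
    moreover have "(2 :: real) * 2 ^ (3 * i + \<kappa>) * 2 ^ i = 2 * 2 ^ ?k i" by (simp flip: power_add)
    ultimately show ?thesis
      using block_certificate_exists[of "M i" "t i" "?k i" "3 * i" i "N i" "2 ^ (3 * i + \<kappa> + 2)" "N (Suc i)"]
        cert(1)[of i] M1 unfolding Q_def by (auto simp: N_def)
  qed
  ultimately obtain h' where h': "computable h'" "\<And>i. ?R i (h' i)"
    using semidecidable_selection[of ?R] by blast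
  show ?thesis
  proof (intro exI conjI allI impI)
    show "computable (\<lambda>i. fst (h' i))" "computable (\<lambda>i. snd (h' i))" by (intro computable_intros h')+
    show "small_cover (3 * i) (fst (h' i)) (Q i) (snd (h' i))" for i by (rule h'(2))
    fix w
    assume "\<forall>\<^sub>F i in sequentially. Q i (bits w (fst (h' i)))"
    then obtain i0 where i0: "\<And>i. i0 \<le> i \<Longrightarrow> Q i (bits w (fst (h' i)))"
      unfolding eventually_sequentially by blast
    let ?a = "\<lambda>n. birkhoff_sum T g n w / real n"
    have close: "\<bar>?a n - mean\<bar> \<le> 6 / 2 ^ i" if "i0 \<le> i" "N i \<le> n" "n < N (Suc i)" "0 < n" for i n
    proof -
      let ?d = "real (2 ^ (3 * i + \<kappa> + 2)) + 2"
      have "\<bar>2 ^ ?k i * birkhoff_sum T g n w - real n * real (t i)\<bar> \<le> real n * ?d"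
        using i0[OF that(1)] that(2,3) unfolding Q_def by (rule close_averages_sound)
      also have "2 ^ ?k i * birkhoff_sum T g n w - real n * real (t i)
          = (real n * 2 ^ ?k i) * (?a n - real (t i) / 2 ^ ?k i)"
        using that(4) by (simp add: field_simps)
      finally have "(real n * 2 ^ ?k i) * \<bar>?a n - real (t i) / 2 ^ ?k i\<bar> \<le> real n * ?d"
        by (simp add: abs_mult)
      then have "\<bar>?a n - real (t i) / 2 ^ ?k i\<bar> \<le> ?d / 2 ^ ?k i"
        using that(4) by (simp add: pos_le_divide_eq mult.commute mult.left_commute)
      also have "\<dots> \<le> 5 / 2 ^ i"
      proof -
        have "(2 :: real) \<le> 2 ^ (3 * i + \<kappa>)"
          using power_increasing[of 1 "3 * i + \<kappa>" "2 :: real"] by (simp add: \<kappa>_def)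
        then have "?d \<le> 5 * 2 ^ (3 * i + \<kappa>)" unfolding of_nat_power by simp
        then have "?d / 2 ^ ?k i \<le> 5 * 2 ^ (3 * i + \<kappa>) / 2 ^ ?k i" by (intro divide_right_mono) auto
        also have "\<dots> = 5 * 2 ^ (3 * i + \<kappa>) / (2 ^ (3 * i + \<kappa>) * 2 ^ i)" by (simp flip: power_add)
        also have "\<dots> = 5 / 2 ^ i" by simp
        finally show ?thesis .
      qed
      finally have 1: "\<bar>?a n - real (t i) / 2 ^ ?k i\<bar> \<le> 5 / 2 ^ i" .
      have "1 / 2 ^ (4 * i) \<le> 1 / (2 :: real) ^ i"
        by (intro divide_left_mono power_increasing) auto
      then have "\<bar>?a n - mean\<bar> \<le> 5 / 2 ^ i + 1 / 2 ^ i" using 1 cert(2)[of i] by linarith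
      then show ?thesis by (simp flip: add_divide_distrib)
    qed
    show "?a \<longlonglongrightarrow> mean"
    proof (rule LIMSEQ_I)
      fix e :: real
      assume "0 < e"
      have "(\<lambda>i. 6 * (1 / 2) ^ i) \<longlonglongrightarrow> 6 * (0 :: real)"
        by (intro tendsto_intros LIMSEQ_power_zero) auto
      then have "\<forall>\<^sub>F i in sequentially. 6 * (1 / 2 :: real) ^ i < e \<and> i0 \<le> i"
        using \<open>0 < e\<close> by (intro eventually_conj order_tendstoD(2) eventually_ge_at_top) auto
      then obtain i1 where i1: "6 * (1 / 2 :: real) ^ i1 < e" "i0 \<le> i1"
        using eventually_happens'[OF sequentially_bot] by blast
      have "norm (?a n - mean) < e" if n: "Suc (N i1) \<le> n" for n
      proof -
        \<comment> \<open>\<open>N\<close> need not be monotone. That \<open>N i \<le> n\<close>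
          follows from the failure of the preceding stage, or from the choice of \<open>n\<close> if
          \<open>i = i1\<close>.\<close>
        define i where "i = (LEAST i. i1 \<le> i \<and> n < N (Suc i))"
        have "i1 \<le> max i1 n \<and> n < N (Suc (max i1 n))" by (auto simp: N_def)
        then have i: "i1 \<le> i" "n < N (Suc i)"
          using LeastI[of "\<lambda>i. i1 \<le> i \<and> n < N (Suc i)"] unfolding i_def by blast+
        have "N i \<le> n"
        proof (cases "i = i1")
          case False
          then obtain j where j: "i = Suc j" "i1 \<le> j" using i(1) by (cases i) auto
          then have "\<not> (i1 \<le> j \<and> n < N (Suc j))"
            using not_less_Least[of j "\<lambda>i. i1 \<le> i \<and> n < N (Suc i)"] unfolding i_def by auto
          then show ?thesis using j by auto
        qed (use n in simp)
        then have "\<bar>?a n - mean\<bar> \<le> 6 / 2 ^ i" using close[of i n] i i1(2) n by simp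
        also have "\<dots> \<le> 6 / 2 ^ i1" using i(1) by (intro divide_left_mono power_increasing) auto
        finally show ?thesis using i1(1) by (simp add: power_one_over)
      qed
      then show "\<exists>n0. \<forall>n\<ge>n0. norm (?a n - mean) < e" by blast
    qed
  qed
qed

end

section \<open>Enumerations of the transformation and of the observable\<close>

lemma graph_map_sound:
  assumes "monotone_graph G" "\<And>w. graph_map G (InfSeq w) = InfSeq (T w)"
    and "(x, y) \<in> G" "FinSeq x \<le> InfSeq w"
  shows "FinSeq y \<le> InfSeq (T w)"
  using ccpo_Sup_upper[OF chain_graph_map[OF assms(1), of "InfSeq w"], of "FinSeq y"] assms(2,3,4)
  unfolding graph_map_def by auto

text \<open>If all outputs along \<open>w\<close> were shorter than \<open>n\<close>, a finite
  string would bound them and hence their supremum, which is infinite.\<close>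

lemma graph_map_complete:
  assumes "monotone_graph G" "\<And>w. graph_map G (InfSeq w) = InfSeq (T w)"
  shows "\<exists>x y. (x, y) \<in> G \<and> FinSeq x \<le> InfSeq w \<and> n \<le> length y"
proof (rule ccontr)
  let ?A = "{FinSeq y |y. \<exists>x. FinSeq x \<le> InfSeq w \<and> (x, y) \<in> G}"
  assume short: "\<not> ?thesis"
  have "a \<le> FinSeq (stake n (T w))" if "a \<in> ?A" for a
  proof -
    from that obtain x y where y: "a = FinSeq y" "FinSeq x \<le> InfSeq w" "(x, y) \<in> G" by blast
    have "length y < n" using short y by (meson not_le)
    moreover have "stake (length y) (T w) = y" using graph_map_sound[OF assms y(3,2)] by simp
    ultimately have "y = take (length y) (stake n (T w))" by (simp add: take_stake)
    then have "prefix y (stake n (T w))" by (metis take_is_prefix)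
    then show ?thesis using y(1) by simp
  qed
  then have "Sup ?A \<le> FinSeq (stake n (T w))"
    by (intro ccpo_Sup_least[OF chain_graph_map[OF assms(1)]])
  then show False using assms(2)[of w] unfolding graph_map_def by simp
qed

definition nat_graph :: "(bool list \<times> bool list) set \<Rightarrow> (nat list \<times> nat list) set" where
  "nat_graph G = map_prod nat_string nat_string ` G"

text \<open>Lists of bits have the same codes under \<open>encode\<close> as under
  \<open>string_code\<close>, so enumerability carries over without translation.\<close>

lemma encode_nat_graph:
  "encode ` nat_graph G = (\<lambda>(x, y). prod_encode (string_code x, string_code y)) ` G"
  by (force simp: nat_graph_def encode_nat_string image_image map_prod_def split: prod.splits)

lemma semidecidable_nat_graph:
  assumes "recursively_enumerable ((\<lambda>(x, y). prod_encode (string_code x, string_code y)) ` G)"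
  shows "semidecidable (\<lambda>p. p \<in> nat_graph G)"
proof -
  have "encode p \<in> encode ` nat_graph G \<longleftrightarrow> p \<in> nat_graph G" for p
    by (rule inj_image_mem_iff[OF bij_is_inj[OF bij_encode]])
  then show ?thesis
    using semidecidable_recursively_enumerable[OF assms, where 'a = "nat list \<times> nat list"]
    by (simp add: encode_nat_graph[symmetric] del: encode_prod_def)
qed

text \<open>Wherever \<open>f\<close> exceeds \<open>a\<close>, some enumerated approximation shows
  it on a whole cylinder, and there are only countably many cylinders.\<close>

lemma computable_real_function_measurable:
  assumes "computable_real_function f"
  shows "f \<in> borel_measurable B_half"
  unfolding borel_measurable_iff_greater
proof
  obtain W where W: "\<And>x k q w. (x, k, q) \<in> W \<Longrightarrow> FinSeq x \<le> InfSeq w \<Longrightarrow> \<bar>f w - of_rat q\<bar> < 1 / 2 ^ k"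
    "\<And>w k. \<exists>x q. FinSeq x \<le> InfSeq w \<and> (x, k, q) \<in> W"
    using assms unfolding computable_real_function_def by metis
  fix a :: real
  let ?I = "{(x, k, q) \<in> W. a \<le> of_rat q - 1 / 2 ^ k}"
  have "{w \<in> space B_half. a < f w} = (\<Union>i\<in>?I. {w. stake (length (fst i)) w = fst i})"
  proof (intro equalityI subsetI)
    fix w
    assume "w \<in> {w \<in> space B_half. a < f w}"
    \<comment> \<open>The lower bound \<open>q - 2 ^ -k\<close> lies less than
      \<open>2 * 2 ^ -k\<close> below \<open>f w\<close>; hence the half.\<close>
    then have "0 < (f w - a) / 2" by simp
    then obtain k where k: "(1 / 2) ^ k < (f w - a) / 2"
      using real_arch_pow_inv[of "(f w - a) / 2" "1 / 2"] by auto
    obtain x q where x: "FinSeq x \<le> InfSeq w" "(x, k, q) \<in> W" using W(2) by blast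
    have "a \<le> of_rat q - 1 / 2 ^ k" using W(1)[OF x(2,1)] k by (simp add: power_one_over)
    then show "w \<in> (\<Union>i\<in>?I. {w. stake (length (fst i)) w = fst i})" using x by force
  next
    fix w
    assume "w \<in> (\<Union>i\<in>?I. {w. stake (length (fst i)) w = fst i})"
    then obtain x k q where x: "(x, k, q) \<in> W" "a \<le> of_rat q - 1 / 2 ^ k" "FinSeq x \<le> InfSeq w" by auto
    then show "w \<in> {w \<in> space B_half. a < f w}" using W(1)[OF x(1,3)] by simp
  qed
  also have "\<dots> \<in> sets B_half"
    by (intro sets.countable_UN'') (auto intro: sets_cylinder)
  finally show "{w \<in> space B_half. a < f w} \<in> sets B_half" .
qed

text \<open>\<open>nat_approx K k a b v\<close>: \<open>v\<close> is the integer part of \<open>2 ^ k * (q + K)\<close>, where \<open>a\<close> and \<open>b\<close> are the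
  codes of the numerator and the positive denominator of \<open>q\<close>. The two cases correspond to the sign
  of the numerator.\<close>

definition nat_approx :: "nat \<Rightarrow> nat \<Rightarrow> nat \<Rightarrow> nat \<Rightarrow> nat \<Rightarrow> bool" where
  "nat_approx K k a b v \<longleftrightarrow> (\<exists>c n. b = 2 * c \<and>
    (a = 2 * n \<and> v * c \<le> 2 ^ k * (n + K * c) \<and> 2 ^ k * (n + K * c) < (v + 1) * c \<or>
     a = Suc (2 * n) \<and> v * c + 2 ^ k * (n + 1) \<le> 2 ^ k * K * c
       \<and> 2 ^ k * K * c < (v + 1) * c + 2 ^ k * (n + 1)))"

lemma nat_approx_iff:
  assumes "0 < d"
  shows "nat_approx K k (int_encode m) (int_encode d) v \<longleftrightarrow>
    real v \<le> 2 ^ k * (of_int m / of_int d + real K) \<and> 2 ^ k * (of_int m / of_int d + real K) < real v + 1"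
proof -
  obtain c where c: "d = int c" "0 < c" using assms by (metis nonneg_int_cases of_nat_0_less_iff less_imp_le)
  have d: "int_encode d = 2 * c" using c by (simp add: int_encode_def sum_encode_def)
  show ?thesis
  proof (cases "0 \<le> m")
    case True
    then obtain n where n: "m = int n" by (metis nonneg_int_cases)
    have m: "int_encode m = 2 * n" using n by (simp add: int_encode_def sum_encode_def)
    have "2 ^ k * (of_int m / of_int d + real K) = real (2 ^ k * (n + K * c)) / real c"
      using c n by (simp add: field_simps)
    moreover have "real v \<le> real (2 ^ k * (n + K * c)) / real c \<longleftrightarrow> v * c \<le> 2 ^ k * (n + K * c)"
      using c(2) by (simp only: pos_le_divide_eq of_nat_0_less_iff flip: of_nat_mult) (simp only: of_nat_le_iff)
    moreover have "real (2 ^ k * (n + K * c)) / real c < real (v + 1) \<longleftrightarrow> 2 ^ k * (n + K * c) < (v + 1) * c"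
      using c(2) by (simp only: pos_divide_less_eq of_nat_0_less_iff flip: of_nat_mult) (simp only: of_nat_less_iff)
    ultimately show ?thesis
      unfolding nat_approx_def m d by (auto simp: add.commute) presburger+
  next
    case False
    \<comment> \<open>\<open>int_encode\<close> assigns the odd code \<open>Suc (2 * n)\<close> to
      the negative integer \<open>- (n + 1)\<close>, and even codes to the nonnegative ones.\<close>
    define n where "n = nat (- m - 1)"
    have n: "m = - int (n + 1)" using False by (simp add: n_def)
    have m: "int_encode m = Suc (2 * n)" using False by (simp add: int_encode_def sum_encode_def n_def)
    have eq: "2 ^ k * (of_int m / of_int d + real K) = (real (2 ^ k * K * c) - real (2 ^ k * (n + 1))) / real c"
    proof -
      have m: "real_of_int m = - (real n + 1)" and d: "real_of_int d = real c" using n c by simp_all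
      show ?thesis unfolding m d using c(2) by (simp add: field_simps)
    qed
    have "real v \<le> (real (2 ^ k * K * c) - real (2 ^ k * (n + 1))) / real c
        \<longleftrightarrow> real (v * c + 2 ^ k * (n + 1)) \<le> real (2 ^ k * K * c)"
      using c(2) by (simp add: pos_le_divide_eq le_diff_eq)
    moreover have "(real (2 ^ k * K * c) - real (2 ^ k * (n + 1))) / real c < real v + 1
        \<longleftrightarrow> real (2 ^ k * K * c) < real ((v + 1) * c + 2 ^ k * (n + 1))"
      using c(2) by (simp add: pos_divide_less_eq diff_less_eq distrib_right add_ac)
    ultimately show ?thesis
      unfolding nat_approx_def m d eq of_nat_le_iff of_nat_less_iff by auto presburger+
  qed
qed

text \<open>Numerator and denominator are kept as separate codes, arranged so that
  \<open>encode\<close> of the quadruple is the number prescribed for the element of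
  \<open>W\<close>.\<close>

definition rat_entries :: "(bool list \<times> nat \<times> rat) set \<Rightarrow> (nat list \<times> nat \<times> nat \<times> nat) set" where
  "rat_entries W = (\<lambda>(x, k, q). (nat_string x, k, int_encode (fst (quotient_of q)),
    int_encode (snd (quotient_of q)))) ` W"

lemma encode_rat_entries:
  "encode ` rat_entries W
    = (\<lambda>(x, k, q). prod_encode (string_code x, prod_encode (k, rat_code q))) ` W"
  by (force simp: rat_entries_def rat_code_def encode_nat_string image_image split: prod.splits)

lemma semidecidable_rat_entries:
  assumes "recursively_enumerable
    ((\<lambda>(x, k, q). prod_encode (string_code x, prod_encode (k, rat_code q))) ` W)"
  shows "semidecidable (\<lambda>p. p \<in> rat_entries W)"
proof -
  have "encode p \<in> encode ` rat_entries W \<longleftrightarrow> p \<in> rat_entries W" for p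
    by (rule inj_image_mem_iff[OF bij_is_inj[OF bij_encode]])
  then show ?thesis
    using semidecidable_recursively_enumerable[OF assms, where 'a = "nat list \<times> nat \<times> nat \<times> nat"]
    by (simp add: encode_rat_entries[symmetric] del: encode_prod_def)
qed

definition nat_values :: "(bool list \<times> nat \<times> rat) set \<Rightarrow> nat \<Rightarrow> nat list \<Rightarrow> nat \<Rightarrow> nat \<Rightarrow> bool" where
  "nat_values W K x k v \<longleftrightarrow> (\<exists>y. prefix y x \<and>
    (\<exists>a b. (y, k, a, b) \<in> rat_entries W \<and> nat_approx K k a b v))"

lemma nat_values_iff:
  "nat_values W K x k v \<longleftrightarrow> (\<exists>y q. prefix (nat_string y) x \<and> (y, k, q) \<in> W \<and>
    real v \<le> 2 ^ k * (of_rat q + real K) \<and> 2 ^ k * (of_rat q + real K) < real v + 1)"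
proof -
  have "nat_approx K k (int_encode (fst (quotient_of q))) (int_encode (snd (quotient_of q))) v \<longleftrightarrow>
    real v \<le> 2 ^ k * (of_rat q + real K) \<and> 2 ^ k * (of_rat q + real K) < real v + 1" for q
  proof -
    obtain m d where md: "quotient_of q = (m, d)" by fastforce
    then have "(of_rat q :: real) = of_int m / of_int d"
      using quotient_of_div[OF md] by (simp add: of_rat_divide)
    then show ?thesis using nat_approx_iff[OF quotient_of_denom_pos[OF md], of K k m v] md by simp
  qed
  then show ?thesis unfolding nat_values_def rat_entries_def by force
qed

lemma semidecidable_nat_values:
  assumes "semidecidable (\<lambda>p. p \<in> rat_entries W)"
  shows "semidecidable (\<lambda>p. nat_values W K (fst p) (fst (snd p)) (snd (snd p)))"
  unfolding nat_values_def nat_approx_def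
  by (intro semidecidable_intros computable_intros
      semidecidable_comp[OF assms, of "\<lambda>p. (snd (fst (fst p)), fst (snd (fst (fst (fst p)))), snd (fst p), snd p)"])

text \<open>The observable is shifted by \<open>K\<close> to become nonnegative. The extra 1 in the
  bound on \<open>f\<close> keeps its rational approximations nonnegative too, as these may be off
  by up to 1, so their scaled integer parts are natural numbers.\<close>

lemma effective_systemI:
  assumes f: "\<And>x k q w. (x, k, q) \<in> W \<Longrightarrow> FinSeq x \<le> InfSeq w \<Longrightarrow> \<bar>f w - of_rat q\<bar> < 1 / 2 ^ k"
      "\<And>w k. \<exists>x q. FinSeq x \<le> InfSeq w \<and> (x, k, q) \<in> W"
      "semidecidable (\<lambda>p. p \<in> rat_entries W)" "f \<in> borel_measurable B_half"
    and K: "\<And>w. \<bar>f w\<bar> + 1 \<le> real K"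
    and G: "monotone_graph G" "\<And>w. graph_map G (InfSeq w) = InfSeq (T w)"
      "semidecidable (\<lambda>p. p \<in> nat_graph G)"
    and T: "preserves_measure B_half T" "ergodic B_half T"
  shows "effective_system T (\<lambda>w. f w + real K) (2 * K) (nat_graph G) (nat_values W K)"
proof unfold_locales
  show "preserves_measure B_half T" "ergodic B_half T" by (rule T)+
  show "(\<lambda>w. f w + real K) \<in> borel_measurable B_half" using f(4) by simp
  show "0 \<le> f w + real K" "f w + real K \<le> real (2 * K)" for w using K[of w] by (simp_all add: abs_le_iff)
  show "semidecidable (\<lambda>p. p \<in> nat_graph G)" by (rule G)
  show "semidecidable (\<lambda>p. nat_values W K (fst p) (fst (snd p)) (snd (snd p)))"
    using f(3) by (rule semidecidable_nat_values)
  show "bits (T w) (length y) = y" if "(x, y) \<in> nat_graph G" "bits w (length x) = x" for x y w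
    using that graph_map_sound[OF G(1,2), of _ _ w] bits_nat_string by (fastforce simp: nat_graph_def)
  show "\<exists>x y. (x, y) \<in> nat_graph G \<and> bits w (length x) = x \<and> n \<le> length y" for w n
  proof -
    obtain x y where "(x, y) \<in> G" "FinSeq x \<le> InfSeq w" "n \<le> length y"
      using graph_map_complete[OF G(1,2)] by blast
    then show ?thesis using bits_nat_string
      by (intro exI[of _ "nat_string x"] exI[of _ "nat_string y"]) (auto simp: nat_graph_def)
  qed
  show "nat_values W K y k v" if "nat_values W K x k v" "prefix x y" for x y k v
    using that prefix_order.trans unfolding nat_values_def by blast
  show "\<bar>2 ^ k * (f w + real K) - real v\<bar> \<le> 2"
    if V: "nat_values W K x k v" and x: "bits w (length x) = x" for x k v w
  proof -
    obtain y q where y: "prefix (nat_string y) x" "(y, k, q) \<in> W"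
      "real v \<le> 2 ^ k * (of_rat q + real K)" "2 ^ k * (of_rat q + real K) < real v + 1"
      using V unfolding nat_values_iff by blast
    have "bits w (length y) = nat_string y" using bits_eq_prefix[OF x y(1)] by simp
    then have "\<bar>f w - of_rat q\<bar> < 1 / 2 ^ k" using f(1)[OF y(2)] bits_nat_string by blast
    then have "2 ^ k * \<bar>f w - of_rat q\<bar> < 1" by (simp add: field_simps)
    then have "\<bar>2 ^ k * (f w - of_rat q)\<bar> < 1" by (simp only: abs_mult power_abs abs_numeral)
    then show ?thesis using y(3,4) by (simp add: right_diff_distrib distrib_left abs_le_iff abs_less_iff)
  qed
  show "\<exists>x v. bits w (length x) = x \<and> nat_values W K x k v" for w k
  proof -
    obtain x q where x: "FinSeq x \<le> InfSeq w" "(x, k, q) \<in> W" using f(2) by blast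
    have "(1 :: real) / 2 ^ k \<le> 1" by simp
    then have "0 \<le> of_rat q + real K" using f(1)[OF x(2,1)] K[of w] by linarith
    then have "0 \<le> 2 ^ k * (of_rat q + real K)" by simp
    then have "nat_values W K (nat_string x) k (nat \<lfloor>2 ^ k * (of_rat q + real K)\<rfloor>)"
      unfolding nat_values_iff using x(2) by (intro exI[of _ x] exI[of _ q]) (auto simp: of_nat_nat)
    then show ?thesis using x(1) bits_nat_string[of w x] by (intro exI[of _ "nat_string x"]) auto
  qed
qed

section \<open>The decoder\<close>

text \<open>The strings in the exceptional set of stage \<open>i\<close> are described by their description of
  length \<open>L i - 3 * i\<close>, preceded by the self-delimiting code of \<open>i\<close>, that is, by \<open>i\<close> ones and a zero.\<close>

definition stage_code :: "nat \<Rightarrow> nat list \<Rightarrow> nat list \<Rightarrow> bool" where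
  "stage_code i u p \<longleftrightarrow> i < length p \<and> (\<forall>j<i. hd (drop j p) = 1) \<and> hd (drop i p) = 0 \<and> drop (Suc i) p = u"

definition decoder :: "(nat \<Rightarrow> (nat list \<times> nat list) list) \<Rightarrow> nat list \<times> nat list \<Rightarrow> bool" where
  "decoder Z a \<longleftrightarrow> is_binary (fst a) \<and> is_binary (snd a) \<and>
    (\<exists>i. \<exists>z. z \<in> set (Z i) \<and> stage_code i (fst z) (fst a) \<and> prefix (snd a) (snd z))"

definition decoder_graph :: "(nat \<Rightarrow> (nat list \<times> nat list) list) \<Rightarrow> (bool list \<times> bool list) set" where
  "decoder_graph Z = {(p, y). decoder Z (nat_string p, nat_string y)}"

lemma stage_code_prefix_unique:
  assumes "stage_code i u p" "stage_code i' u' p'" "prefix p p'"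
  shows "i = i'" "prefix u u'"
proof -
  obtain r where r: "p' = p @ r" using assms(3) by (rule prefixE)
  have eq: "hd (drop j p') = hd (drop j p)" if "j \<le> i" for j
    using that assms(1) by (simp add: r stage_code_def)
  show i: "i = i'"
  proof (rule linorder_cases[of i i'])
    assume "i < i'"
    then show ?thesis using assms(1,2) eq[of i] by (auto simp: stage_code_def)
  next
    assume "i' < i"
    then show ?thesis using assms(1,2) eq[of i'] by (auto simp: stage_code_def)
  qed
  show "prefix u u'" using assms(1,2) by (auto simp: stage_code_def r i)
qed

lemma stage_code_append: "stage_code i u (replicate i 1 @ 0 # u)"
  by (auto simp: stage_code_def hd_append drop_append)

lemma semidecidable_decoder:
  assumes "computable Z"
  shows "semidecidable (decoder Z)"
  unfolding decoder_def[abs_def] stage_code_def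
  by (intro semidecidable_intros computable_intros computable_comp[OF assms])

lemma decoder_graph_computable:
  assumes "computable Z"
  shows "recursively_enumerable ((\<lambda>(x, y). prod_encode (string_code x, string_code y)) ` decoder_graph Z)"
proof -
  have "nat_graph (decoder_graph Z) = Collect (decoder Z)"
    unfolding nat_graph_def decoder_graph_def
    by (force simp: decoder_def binary_iff_nat_string)
  then show ?thesis
    using recursively_enumerable_semidecidable[OF semidecidable_decoder[OF assms]]
    by (simp only: encode_nat_graph[symmetric])
qed

text \<open>A program and its extension belong to the same stage, where all descriptions have length
  \<open>L i - m i\<close>; so their descriptions coincide. As \<open>Z\<close> is single-valued,
  both outputs are prefixes of one string.\<close>

lemma monotone_decoder_graph:
  assumes cover: "\<And>i. small_cover (m i) (L i) (Q i) (Z i)"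
  shows "monotone_graph (decoder_graph Z)"
  unfolding monotone_graph_def
proof (intro conjI allI impI)
  fix p y p' y'
  assume "(p, y) \<in> decoder_graph Z" "(p', y') \<in> decoder_graph Z" and pp': "prefix p p'"
  then obtain i z i' z' where z: "z \<in> set (Z i)" "stage_code i (fst z) (nat_string p)" "prefix (nat_string y) (snd z)"
    and z': "z' \<in> set (Z i')" "stage_code i' (fst z') (nat_string p')" "prefix (nat_string y') (snd z')"
    unfolding decoder_graph_def decoder_def by auto
  have i: "i = i'" and "prefix (fst z) (fst z')"
    using stage_code_prefix_unique[OF z(2) z'(2)] pp' by simp_all
  moreover have "length (fst z) + m i = L i" "length (fst z') + m i = L i"
    using cover[of i] z(1) z'(1) i unfolding small_cover_def by blast+
  ultimately have "prefix (fst z) (fst z')" "length (fst z) = length (fst z')" by linarith+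
  then have "fst z = fst z'" by (auto simp: prefix_def)
  then have "snd z = snd z'" using cover[of i] z(1) z'(1) i unfolding small_cover_def by blast
  then have "prefix (nat_string y) (nat_string y') \<or> prefix (nat_string y') (nat_string y)"
    using z(3) z'(3) prefix_same_cases by metis
  then show "prefix y y' \<or> prefix y' y" by simp
next
  fix p y y'
  assume "(p, y) \<in> decoder_graph Z" "prefix y' y"
  then show "(p, y') \<in> decoder_graph Z"
    using map_mono_prefix[of y' y of_bool] prefix_order.trans unfolding decoder_graph_def decoder_def
    by auto blast
qed

text \<open>The stage code takes \<open>i + 1\<close> bits, the description of the bad string
  \<open>L i - m i\<close>.\<close>

lemma Km_decoder_graph:
  assumes cover: "\<And>i. small_cover (m i) (L i) (Q i) (Z i)" and bad: "\<not> Q i (bits w (L i))"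
  shows "Km (graph_map (decoder_graph Z)) (stake (L i) w) \<le> enat (i + 1 + (L i - m i))"
proof -
  obtain z where z: "z \<in> set (Z i)" "snd z = bits w (L i)"
    using cover[of i] bad unfolding small_cover_def by (metis binary_bits length_bits)
  have "is_binary (fst z)" and len: "length (fst z) + m i = L i"
    using cover[of i] z(1) unfolding small_cover_def by blast+
  then obtain u where u: "fst z = nat_string u" by (auto simp: binary_iff_nat_string)
  let ?p = "replicate i True @ False # u" and ?x = "stake (L i) w"
  have "nat_string ?p = replicate i 1 @ 0 # fst z" by (simp add: u)
  then have "stage_code i (fst z) (nat_string ?p)" using stage_code_append by metis
  then have "decoder Z (nat_string ?p, nat_string ?x)"
    unfolding decoder_def using z binary_nat_string[of ?p]
    by (intro conjI exI[of _ i] exI[of _ z]) (simp_all add: bits_def del: map_append binary_nat_string, simp)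
  then have p: "(?p, ?x) \<in> decoder_graph Z" by (simp add: decoder_graph_def del: map_append)
  have "FinSeq ?x \<le> graph_map (decoder_graph Z) (FinSeq ?p)"
    unfolding graph_map_def
    by (rule ccpo_Sup_upper[OF chain_graph_map[OF monotone_decoder_graph[OF cover]]])
      (use p in \<open>force simp del: less_eq_bseq.simps intro: order_refl\<close>)
  then have "Km (graph_map (decoder_graph Z)) ?x \<le> enat (length ?p)"
    unfolding Km_def by (intro INF_lower) simp
  also have "length ?p = i + 1 + (L i - m i)"
    using len u by (simp flip: length_map[of of_bool u])
  finally show ?thesis .
qed

section \<open>The function \<open>\<sigma>\<close> and the convergence of the averages\<close>

theorem theorem1:
  fixes \<psi> :: "bseq \<Rightarrow> bseq"
    and f :: "bool stream \<Rightarrow> real"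
    and T :: "bool stream \<Rightarrow> bool stream"
  assumes "optimal_decoder \<psi>"
    and "computable_observable f"
    and "computable_transformation T"
    and "preserves_measure B_half T"
    and "ergodic B_half T"
  shows "\<exists>\<sigma> :: nat \<Rightarrow> nat. total_computable \<sigma> \<and> mono \<sigma> \<and> \<not> bdd_above (range \<sigma>) \<and>
    (\<forall>\<omega>. (\<exists>c::real. \<forall>\<^sub>F n in sequentially.
              ereal_of_enat (Km \<psi> (stake n \<omega>)) \<ge> ereal (real n - real (\<sigma> n) - c))
        \<longrightarrow> convergent (\<lambda>n. (1 / real n) * (\<Sum>k<n. f ((T ^^ k) \<omega>))))"
proof -
  have f: "computable_real_function f" "bounded (range f)"
    using assms(2) by (simp_all add: computable_observable_def)
  obtain W where W: "recursively_enumerable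
      ((\<lambda>(x, k, q). prod_encode (string_code x, prod_encode (k, rat_code q))) ` W)"
    "\<And>x k q w. (x, k, q) \<in> W \<Longrightarrow> FinSeq x \<le> InfSeq w \<Longrightarrow> \<bar>f w - of_rat q\<bar> < 1 / 2 ^ k"
    "\<And>w k. \<exists>x q. FinSeq x \<le> InfSeq w \<and> (x, k, q) \<in> W"
    using f(1) unfolding computable_real_function_def by metis
  obtain b where b: "\<And>w. \<bar>f w\<bar> \<le> b" using f(2) by (auto simp: bounded_iff)
  obtain K where "b + 1 \<le> real K" using real_arch_simple by blast
  then have K: "\<bar>f w\<bar> + 1 \<le> real K" for w using b[of w] by linarith
  obtain G where G: "monotone_graph G"
    "recursively_enumerable ((\<lambda>(x, y). prod_encode (string_code x, string_code y)) ` G)"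
    "\<And>w. graph_map G (InfSeq w) = InfSeq (T w)"
    using assms(3) unfolding computable_transformation_def computable_monotonic_def by blast
  interpret effective_system T "\<lambda>w. f w + real K" "2 * K" "nat_graph G" "nat_values W K"
    by (rule effective_systemI) (use W(2,3) K G(1,3) assms(4,5) semidecidable_nat_graph[OF G(2)]
      semidecidable_rat_entries[OF W(1)] computable_real_function_measurable[OF f(1)] in blast)+
  obtain L Z Q where LZQ: "computable L \<and> computable Z \<and> (\<forall>i. small_cover (3 * i) (L i) (Q i) (Z i)) \<and>
    (\<forall>w. (\<forall>\<^sub>F i in sequentially. Q i (bits w (L i)))
      \<longrightarrow> (\<lambda>n. birkhoff_sum T (\<lambda>w. f w + real K) n w / real n) \<longlonglongrightarrow> mean)"
    using effective_rate by (elim exE) (rule that)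
  then have L: "computable L" and Z: "computable Z" by blast+
  have cover: "small_cover (3 * i) (L i) (Q i) (Z i)" for i
    using LZQ by blast
  have lim: "(\<lambda>n. birkhoff_sum T (\<lambda>w. f w + real K) n w / real n) \<longlonglongrightarrow> mean"
    if "\<forall>\<^sub>F i in sequentially. Q i (bits w (L i))" for w
    using LZQ that by blast
  \<comment> \<open>This makes \<open>L i\<close> tend to infinity, so \<open>\<sigma>\<close> is
    total and the hypothesis applies at length \<open>L i\<close> for all large
    \<open>i\<close>.\<close>
  have L_ge: "3 * i \<le> L i" for i using cover[of i] by (simp add: small_cover_def)
  have "computable_monotonic (graph_map (decoder_graph Z))"
    unfolding computable_monotonic_def
    by (intro exI[of _ "decoder_graph Z"] conjI refl monotone_decoder_graph[OF cover]
        decoder_graph_computable[OF Z])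
  then obtain c0 :: nat where c0: "\<And>x. Km \<psi> x \<le> Km (graph_map (decoder_graph Z)) x + enat c0"
    using assms(1) unfolding optimal_decoder_def by blast
  define \<sigma> where "\<sigma> n = (LEAST s. n \<le> L s)" for n
  have ex: "\<exists>s. n \<le> L s" for n using L_ge[of n] by (intro exI[of _ n]) simp
  have \<sigma>: "n \<le> L (\<sigma> n)" for n unfolding \<sigma>_def using ex by (rule LeastI_ex)
  have \<sigma>_le: "\<sigma> n \<le> s" if "n \<le> L s" for n s unfolding \<sigma>_def using that by (rule Least_le)
  have "computable \<sigma>"
  proof -
    have "computable (\<lambda>n. LEAST s. n - L s = 0)"
      by (rule computable_Least) (use ex in \<open>auto intro!: computable_intros computable_comp[OF L]\<close>)
    then show ?thesis by (simp add: \<sigma>_def[abs_def])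
  qed
  moreover have "mono \<sigma>" using \<sigma> \<sigma>_le by (meson monoI order_trans)
  moreover have "\<not> bdd_above (range \<sigma>)"
  proof
    assume "bdd_above (range \<sigma>)"
    then obtain s where s: "\<And>n. \<sigma> n \<le> s" by (auto simp: bdd_above_def)
    \<comment> \<open>\<open>L\<close> need not be monotone, so the sum serves as a common bound for
      its values up to \<open>s\<close>.\<close>
    have "n \<le> (\<Sum>i\<le>s. L i)" for n
      using \<sigma>[of n] member_le_sum[of "\<sigma> n" "{..s}" L] s[of n] by simp
    then show False using not_less_eq_eq by blast
  qed
  moreover have "convergent (\<lambda>n. (1 / real n) * (\<Sum>k<n. f ((T ^^ k) \<omega>)))"
    if random: "\<forall>\<^sub>F n in sequentially.
      ereal_of_enat (Km \<psi> (stake n \<omega>)) \<ge> ereal (real n - real (\<sigma> n) - c)" for \<omega> c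
  proof -
    obtain n0 where n0: "\<And>n. n0 \<le> n \<Longrightarrow>
        ereal_of_enat (Km \<psi> (stake n \<omega>)) \<ge> ereal (real n - real (\<sigma> n) - c)"
      using random unfolding eventually_sequentially by blast
    \<comment> \<open>The constants to be exceeded are \<open>c\<close> from the hypothesis,
      \<open>c0\<close> from the optimality of \<open>\<psi>\<close>, and 1 for the zero that ends
      the stage code.\<close>
    obtain i0 where i0: "c + real c0 + 1 < real i0" using reals_Archimedean2 by blast
    have "Q i (bits \<omega> (L i))" if i: "max n0 i0 \<le> i" for i
    proof (rule ccontr)
      assume "\<not> Q i (bits \<omega> (L i))"
      then have "Km (graph_map (decoder_graph Z)) (stake (L i) \<omega>) \<le> enat (i + 1 + (L i - 3 * i))"
        by (rule Km_decoder_graph[OF cover])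
      then have "Km \<psi> (stake (L i) \<omega>) \<le> enat (i + 1 + (L i - 3 * i)) + enat c0"
        using c0[of "stake (L i) \<omega>"] by (meson add_right_mono order_trans)
      then have "ereal_of_enat (Km \<psi> (stake (L i) \<omega>)) \<le> ereal (real (i + 1 + (L i - 3 * i) + c0))"
        by (metis ereal_of_enat_le_iff ereal_of_enat_simps(1) plus_enat_simps(1))
      moreover have "n0 \<le> L i" using i L_ge[of i] by simp
      ultimately have "ereal (real (L i) - real (\<sigma> (L i)) - c) \<le> ereal (real (i + 1 + (L i - 3 * i) + c0))"
        using n0 order_trans by blast
      then have "real (L i) - real (\<sigma> (L i)) - c \<le> real i + 1 + (real (L i) - 3 * real i) + real c0"
        using L_ge[of i] by (simp add: of_nat_diff)
      moreover have "real (\<sigma> (L i)) \<le> real i" "real i0 \<le> real i" using \<sigma>_le[of "L i" i] i by simp_all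
      ultimately show False using i0 by linarith
    qed
    then have "\<forall>\<^sub>F i in sequentially. Q i (bits \<omega> (L i))" unfolding eventually_sequentially by blast
    from tendsto_diff[OF lim[OF this] tendsto_const]
    have "(\<lambda>n. birkhoff_sum T (\<lambda>w. f w + real K) n \<omega> / real n - real K) \<longlonglongrightarrow> mean - real K" .
    \<comment> \<open>For \<open>n = 0\<close> division by zero makes both averages 0, so they
      differ by \<open>K\<close> only for positive \<open>n\<close>.\<close>
    moreover have "\<forall>\<^sub>F n in sequentially. birkhoff_sum T (\<lambda>w. f w + real K) n \<omega> / real n - real K
        = (1 / real n) * (\<Sum>k<n. f ((T ^^ k) \<omega>))"
      using eventually_gt_at_top[of 0]
      by eventually_elim (simp add: birkhoff_sum_def sum.distrib add_divide_distrib)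
    ultimately have "(\<lambda>n. (1 / real n) * (\<Sum>k<n. f ((T ^^ k) \<omega>))) \<longlonglongrightarrow> mean - real K"
      by (rule Lim_transform_eventually)
    then show ?thesis by (rule convergentI)
  qed
  ultimately show ?thesis
    unfolding computable_nat_iff by (intro exI[of _ \<sigma>] conjI allI impI; (elim exE)?)
qed

end
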